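(* Let $G=(V,E)$ be a simple $n$-vertex graph. There is a zero-error randomized algorithm that makes $O(n)$ cut queries in expectation and outputs a spanning forest of $G$.
   Context: A simple graph is undirected, unweighted, loopless, with at most one edge between any pair of vertices. For $S\subseteq V$, $\mathrm{cut}_G(S)$ is the set of edges with exactly one endpoint in $S$; a cut query specifies $S\subseteq V$ and returns $|\mathrm{cut}_G(S)|$. The algorithm accesses $G$ only through cut queries. Zero-error means the output is always correct; only the number of queries is random. *)

theory Defs
  imports "HOL-Probability.Probability" "HOL-Library.Landau_Symbols"
begin

section \<open>Simple graphs, cuts and spanning forests\<close>

text \<open>
  An edge is the unordered pair of its endpoints, a two-element set of vertices, so loops and
  parallel edges cannot occur. (The symmetric digraphs of \<open>Graph_Theory\<close> are not used:
  there the walk \<open>a, b, a\<close> is a cycle, so its \<open>forest\<close> is not acyclicity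
  of an undirected graph.)
\<close>

definition simple_graph :: "'v set \<Rightarrow> 'v set set \<Rightarrow> bool" where
  "simple_graph V E \<longleftrightarrow> finite V \<and> (\<forall>e\<in>E. e \<subseteq> V \<and> card e = 2)"

definition cut :: "'v set set \<Rightarrow> 'v set \<Rightarrow> 'v set set" where
  "cut E S = {e \<in> E. card (e \<inter> S) = 1}"

definition adjacency :: "'v set set \<Rightarrow> ('v \<times> 'v) set" where
  "adjacency E = {(u, v). {u, v} \<in> E}"

definition cycle :: "'v set set \<Rightarrow> 'v list \<Rightarrow> bool" where
  "cycle E vs \<longleftrightarrow> 3 \<le> length vs \<and> distinct vs \<and>
     (\<forall>i < length vs. {vs ! i, vs ! (Suc i mod length vs)} \<in> E)"

definition acyclic_edges :: "'v set set \<Rightarrow> bool" where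
  "acyclic_edges E \<longleftrightarrow> (\<nexists>vs. cycle E vs)"

text \<open>
  The graph is not assumed to be connected. A spanning forest has the same connected components
  as the graph itself, i.e. it consists of one spanning tree for each component; it is given by
  its edge set, its vertex set being that of the graph.
\<close>

definition spanning_forest :: "'v set set \<Rightarrow> 'v set set \<Rightarrow> bool" where
  "spanning_forest E F \<longleftrightarrow>
     F \<subseteq> E \<and> acyclic_edges F \<and> (adjacency F)\<^sup>* = (adjacency E)\<^sup>*"


section \<open>Randomized query algorithms\<close>

text \<open>
  A randomized adaptive algorithm with query access to an unknown function \<open>'q \<Rightarrow> 'r\<close>
  is a decision tree. A node outputs a result, asks a query and continues depending on the answer,
  or continues at random with an algorithm drawn from an arbitrary discrete distribution. As usual
  for query complexity, only queries are charged for and the computation between them is not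
  restricted. Every branch of the tree is finite, so each run halts, but since
  \<open>Sample\<close> may branch infinitely, the number of queries need not be bounded.
\<close>

datatype ('q, 'r, 'a) query_alg =
    Output 'a
  | Query 'q "'r \<Rightarrow> ('q, 'r, 'a) query_alg"
  | Sample "('q, 'r, 'a) query_alg pmf"

text \<open>
  The joint distribution of the list of queries asked and the output produced when the queries
  are answered by the function \<open>oracle_fun\<close>.
\<close>

primrec run :: "('q \<Rightarrow> 'r) \<Rightarrow> ('q, 'r, 'a) query_alg \<Rightarrow> ('q list \<times> 'a) pmf" where
  "run oracle_fun (Output x) = return_pmf ([], x)"
| "run oracle_fun (Query q k) =
     map_pmf (\<lambda>(qs, x). (q # qs, x)) (run oracle_fun (k (oracle_fun q)))"
| "run oracle_fun (Sample p) = join_pmf (map_pmf (run oracle_fun) p)"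

definition expected_queries :: "('q \<Rightarrow> 'r) \<Rightarrow> ('q, 'r, 'a) query_alg \<Rightarrow> ennreal" where
  "expected_queries oracle_fun A =
     (\<integral>\<^sup>+ (qs, x). of_nat (length qs) \<partial>measure_pmf (run oracle_fun A))"

definition zero_error :: "('q \<Rightarrow> 'r) \<Rightarrow> ('q, 'r, 'a) query_alg \<Rightarrow> ('a \<Rightarrow> bool) \<Rightarrow> bool" where
  "zero_error oracle_fun A correct \<longleftrightarrow> (\<forall>(qs, x) \<in> set_pmf (run oracle_fun A). correct x)"

definition queries_in :: "'q set \<Rightarrow> ('q \<Rightarrow> 'r) \<Rightarrow> ('q, 'r, 'a) query_alg \<Rightarrow> bool" where
  "queries_in Q oracle_fun A \<longleftrightarrow> (\<forall>(qs, x) \<in> set_pmf (run oracle_fun A). set qs \<subseteq> Q)"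


section \<open>Cut queries\<close>

definition cut_query :: "'v set set \<Rightarrow> 'v set \<Rightarrow> nat" where
  "cut_query E S = card (cut E S)"

type_synonym ('v, 'a) cut_alg = "('v set, nat, 'a) query_alg"

end

theory Submission
  imports Defs
begin

text \<open>
  The algorithm contracts connected pieces as in Boruvka's method. For disjoint \<open>A\<close> and \<open>B\<close>,
  three cut queries yield the number of edges between them. In a round with \<open>p\<close> pieces, a random
  half of the pieces is declared left. In each left piece with an edge to the right side \<open>R\<close>, binary
  search finds an endpoint \<open>u\<close> of such an edge; as the pieces have total size at most \<open>n\<close>, this
  costs \<open>O(sqrt (p n))\<close> queries overall. If \<open>u\<close> has about \<open>2 ^ s\<close> neighbours in \<open>R\<close>, then with
  constant probability it has exactly one neighbour in a random subset of \<open>R\<close> of density \<open>2 ^ - s\<close>.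
  Each bit of the names of these unique neighbours is a 0/1-vector indexed by the successful \<open>u\<close>;
  a coin-weighing scheme determines it with a factor \<open>log n\<close> fewer queries than it has entries, so
  that all \<open>log n\<close> bits together cost \<open>O(1)\<close> queries per vertex \<open>u\<close>, up to a lower-order term.
  Hence the expected number of pieces drops geometrically at a cost of \<open>O(sqrt (p n))\<close> per round,
  and after logarithmically many rounds the few remaining pieces are merged by plain binary search.
\<close>

section \<open>Query algorithms and edge counts\<close>

text \<open>Binary search for both endpoints of an edge would cost log n queries per piece and give
  only O(n log n). The near endpoint is cheap, since small pieces need few search steps, but the far
  one may lie anywhere. Hence the detour through unique neighbours: with them, edge counts become
  weighings of 0/1-vectors.

  The search cost log |C| is bounded by a square root because Cauchy-Schwarz then yields sqrt (p n),
  and sqrt p decays geometrically along with p, so the sum over all rounds is O(n). Weighings come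
  in blocks of about sqrt n; partly filled blocks cost about sqrt n log^2 n per round, which stays
  below O(n) over O(log n) rounds.

  Randomness affects only the progress: every answer is exact and every added edge is certain, hence
  zero error. The recursion over rounds uses a bound that is affine in the number of pieces, so that
  only the expectation of this number matters.\<close>

lemma run_Sample: "run f (Sample p) = bind_pmf p (run f)"
  by (simp add: bind_eq_join_pmf)

lemma expected_queries_Output [simp]: "expected_queries f (Output x) = 0"
  by (simp add: expected_queries_def)

lemma expected_queries_Query:
  "expected_queries f (Query q k) = 1 + expected_queries f (k (f q))"
proof -
  have "expected_queries f (Query q k) =
    (\<integral>\<^sup>+ x. 1 + of_nat (length (fst x)) \<partial>measure_pmf (run f (k (f q))))"
    by (simp add: expected_queries_def case_prod_unfold)
  also have "\<dots> = 1 + expected_queries f (k (f q))"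
    by (subst nn_integral_add) (simp_all add: expected_queries_def case_prod_unfold)
  finally show ?thesis .
qed

lemma expected_queries_Sample:
  "expected_queries f (Sample p) = (\<integral>\<^sup>+ A. expected_queries f A \<partial>measure_pmf p)"
  unfolding expected_queries_def run_Sample by (simp add: nn_integral_bind_pmf)

section \<open>Edge counts from cut queries\<close>

definition edges_between :: "'v set set \<Rightarrow> 'v set \<Rightarrow> 'v set \<Rightarrow> nat" where
  "edges_between E A B = card {(x, y). x \<in> A \<and> y \<in> B \<and> {x, y} \<in> E}"

lemma simple_graph_finite: "simple_graph V E \<Longrightarrow> finite E"
  unfolding simple_graph_def by (meson Pow_iff finite_Pow_iff finite_subset subsetI)

text \<open>An edge joining \<open>A\<close> and \<open>B\<close> lies in both single cuts but has
  two endpoints in \<open>A \<union> B\<close>; every other edge contributes equally to both sides.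
  The factor 2 on the left avoids division and truncated subtraction.\<close>

lemma edges_between_cut_query:
  assumes G: "simple_graph V E" and AB: "A \<inter> B = {}"
  shows "2 * edges_between E A B + cut_query E (A \<union> B) = cut_query E A + cut_query E B"
proof -
  have finE: "finite E" using G by (rule simple_graph_finite)
  define X where "X = {e \<in> E. card (e \<inter> A) = 1 \<and> card (e \<inter> B) = 1}"
  define Y where "Y A B = {e \<in> E. card (e \<inter> A) = 1 \<and> card (e \<inter> B) = 0}" for A B
  have un: "card (e \<inter> (A \<union> B)) = card (e \<inter> A) + card (e \<inter> B)" if "e \<in> E" for e
  proof -
    have "finite e" using G that by (auto simp: simple_graph_def intro: finite_subset)
    then show ?thesis using AB by (subst card_Un_disjoint [symmetric]) (auto simp: Int_Un_distrib)
  qed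
  have le: "card (e \<inter> A) + card (e \<inter> B) \<le> 2" if "e \<in> E" for e
  proof -
    have e: "card e = 2" "finite e" using G that by (auto simp: simple_graph_def intro: finite_subset)
    have "card (e \<inter> (A \<union> B)) \<le> card e" using e by (intro card_mono) auto
    then show ?thesis using un[OF that] e by simp
  qed
  have fin: "finite X" "finite (Y A B)" "finite (Y B A)" using finE by (auto simp: X_def Y_def)
  have "cut E A = X \<union> Y A B" using le unfolding cut_def X_def Y_def by force
  moreover have "X \<inter> Y A B = {}" by (auto simp: X_def Y_def)
  ultimately have 1: "cut_query E A = card X + card (Y A B)"
    using fin by (simp add: cut_query_def card_Un_disjoint)
  have "cut E B = X \<union> Y B A" using le unfolding cut_def X_def Y_def by force
  moreover have "X \<inter> Y B A = {}" by (auto simp: X_def Y_def)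
  ultimately have 2: "cut_query E B = card X + card (Y B A)"
    using fin by (simp add: cut_query_def card_Un_disjoint)
  have "cut E (A \<union> B) = Y A B \<union> Y B A"
    using un unfolding cut_def Y_def by auto
  moreover have "Y A B \<inter> Y B A = {}" by (auto simp: Y_def)
  ultimately have 3: "cut_query E (A \<union> B) = card (Y A B) + card (Y B A)"
    using fin by (simp add: cut_query_def card_Un_disjoint)
  have "bij_betw (\<lambda>(x, y). {x, y}) {(x, y). x \<in> A \<and> y \<in> B \<and> {x, y} \<in> E} X"
  proof (rule bij_betwI')
    fix p q assume "p \<in> {(x, y). x \<in> A \<and> y \<in> B \<and> {x, y} \<in> E}"
      "q \<in> {(x, y). x \<in> A \<and> y \<in> B \<and> {x, y} \<in> E}"
    then show "((case p of (x, y) \<Rightarrow> {x, y}) = (case q of (x, y) \<Rightarrow> {x, y})) = (p = q)"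
      using AB by (auto simp: doubleton_eq_iff)
  next
    fix p assume "p \<in> {(x, y). x \<in> A \<and> y \<in> B \<and> {x, y} \<in> E}"
    then obtain x y where p: "p = (x, y)" "x \<in> A" "y \<in> B" "{x, y} \<in> E" by auto
    then have eq: "{x, y} \<inter> A = {x}" "{x, y} \<inter> B = {y}" using AB by auto
    have "card ({x, y} \<inter> A) = 1" "card ({x, y} \<inter> B) = 1" unfolding eq by simp_all
    then show "(case p of (x, y) \<Rightarrow> {x, y}) \<in> X" using p by (simp add: X_def)
  next
    fix e assume e: "e \<in> X"
    then obtain x y where "e \<inter> A = {x}" "e \<inter> B = {y}"
      by (auto simp: X_def card_1_singleton_iff)
    then have xy: "x \<in> A" "y \<in> B" "x \<in> e" "y \<in> e" "x \<noteq> y" using AB by auto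
    moreover have "card e = 2" "finite e"
      using e G by (auto simp: X_def simple_graph_def intro: finite_subset)
    ultimately have "e = {x, y}" by (auto simp: card_2_iff)
    then show "\<exists>p \<in> {(x, y). x \<in> A \<and> y \<in> B \<and> {x, y} \<in> E}. e = (case p of (x, y) \<Rightarrow> {x, y})"
      using xy e by (intro bexI[of _ "(x, y)"]) (auto simp: X_def)
  qed
  then have "edges_between E A B = card X"
    unfolding edges_between_def by (rule bij_betw_same_card)
  then show ?thesis using 1 2 3 by simp
qed

lemma edges_between_pos_iff:
  assumes "simple_graph V E"
  shows "0 < edges_between E A B \<longleftrightarrow> (\<exists>x\<in>A. \<exists>y\<in>B. {x, y} \<in> E)"
proof -
  have "{(x, y). x \<in> A \<and> y \<in> B \<and> {x, y} \<in> E} \<subseteq> V \<times> V"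
    using assms by (auto simp: simple_graph_def)
  then have "finite {(x, y). x \<in> A \<and> y \<in> B \<and> {x, y} \<in> E}"
    using assms by (auto simp: simple_graph_def intro: finite_subset)
  then show ?thesis by (auto simp: edges_between_def card_gt_0_iff)
qed

text \<open>
  \<open>\<E>\<close> is the set of graphs that are consistent with the answers received so far. Since the
  continuation after a query is chosen separately for each answer, only the information carried by
  the answers matters and no decoding procedure has to be written down.
\<close>

definition solvable :: "'v set \<Rightarrow> 'v set set set \<Rightarrow> ('v set set \<Rightarrow> real) \<Rightarrow> bool" where
  "solvable V \<E> c \<longleftrightarrow> (\<exists>A :: ('v, 'v set set) cut_alg. \<forall>E\<in>\<E>.
     queries_in (Pow V) (cut_query E) A \<and> zero_error (cut_query E) A (spanning_forest E) \<and>
     0 \<le> c E \<and> expected_queries (cut_query E) A \<le> ennreal (c E))"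

lemma solvable_mono:
  assumes "solvable V \<E> c" "\<And>E. E \<in> \<E>' \<Longrightarrow> E \<in> \<E>" "\<And>E. E \<in> \<E>' \<Longrightarrow> c E \<le> c' E"
  shows "solvable V \<E>' c'"
  using assms unfolding solvable_def by (meson ennreal_leI order_trans)

text \<open>Answers that no graph produces need no algorithm. Later proofs can therefore take some
  consistent graph \<open>E0\<close> and read off it properties of \<open>F\<close> and
  \<open>P\<close>, such as finiteness and disjointness, that do not mention the graph.\<close>

lemma solvable_empty: "solvable V {} c"
  by (simp add: solvable_def)

lemma solvable_Output:
  assumes "\<And>E. E \<in> \<E> \<Longrightarrow> spanning_forest E F"
  shows "solvable V \<E> (\<lambda>_. 0)"
  unfolding solvable_def
  by (rule exI[of _ "Output F"]) (auto simp: queries_in_def zero_error_def assms)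

lemma solvable_Query:
  assumes q: "q \<subseteq> V" and s: "\<And>r. solvable V {E \<in> \<E>. cut_query E q = r} c"
  shows "solvable V \<E> (\<lambda>E. 1 + c E)"
proof -
  obtain A where A: "\<And>r E. E \<in> {E \<in> \<E>. cut_query E q = r} \<Longrightarrow>
     queries_in (Pow V) (cut_query E) (A r) \<and> zero_error (cut_query E) (A r) (spanning_forest E) \<and>
     0 \<le> c E \<and> expected_queries (cut_query E) (A r) \<le> ennreal (c E)"
    using s unfolding solvable_def by metis
  show ?thesis unfolding solvable_def
  proof (rule exI[of _ "Query q A"], intro ballI)
    fix E assume "E \<in> \<E>"
    from A[of E "cut_query E q"] this
    have B: "queries_in (Pow V) (cut_query E) (A (cut_query E q))"
      "zero_error (cut_query E) (A (cut_query E q)) (spanning_forest E)" "0 \<le> c E"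
      "expected_queries (cut_query E) (A (cut_query E q)) \<le> ennreal (c E)" by auto
    have "expected_queries (cut_query E) (Query q A) \<le> 1 + ennreal (c E)"
      using B(4) by (simp add: expected_queries_Query)
    also have "\<dots> = ennreal (1 + c E)" using B(3) by simp
    finally show "queries_in (Pow V) (cut_query E) (Query q A) \<and>
      zero_error (cut_query E) (Query q A) (spanning_forest E) \<and> 0 \<le> 1 + c E \<and>
      expected_queries (cut_query E) (Query q A) \<le> ennreal (1 + c E)"
      using B q by (fastforce simp: queries_in_def zero_error_def)
  qed
qed

text \<open>The cost \<open>c x E\<close> may depend on the graph because the progress made by a
  random choice does; the expectation is taken for each graph separately. Finite support makes every
  real function integrable.\<close>

lemma solvable_Sample:
  assumes fin: "finite (set_pmf p)" and s: "\<And>x. x \<in> set_pmf p \<Longrightarrow> solvable V \<E> (c x)"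
  shows "solvable V \<E> (\<lambda>E. measure_pmf.expectation p (\<lambda>x. c x E))"
proof -
  obtain A where A: "\<And>x E. x \<in> set_pmf p \<Longrightarrow> E \<in> \<E> \<Longrightarrow>
     queries_in (Pow V) (cut_query E) (A x) \<and> zero_error (cut_query E) (A x) (spanning_forest E) \<and>
     0 \<le> c x E \<and> expected_queries (cut_query E) (A x) \<le> ennreal (c x E)"
    using s unfolding solvable_def by metis
  show ?thesis unfolding solvable_def
  proof (rule exI[of _ "Sample (map_pmf A p)"], intro ballI)
    fix E assume E: "E \<in> \<E>"
    have int: "integrable (measure_pmf p) (\<lambda>x. c x E)"
      by (rule integrable_measure_pmf_finite [OF fin])
    have nonneg: "AE x in measure_pmf p. 0 \<le> c x E" using A E by (simp add: AE_measure_pmf_iff)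
    have "expected_queries (cut_query E) (Sample (map_pmf A p)) \<le>
        (\<integral>\<^sup>+ x. ennreal (c x E) \<partial>measure_pmf p)"
      unfolding expected_queries_Sample nn_integral_map_pmf
      by (rule nn_integral_mono_AE) (use A E in \<open>simp add: AE_measure_pmf_iff\<close>)
    also have "\<dots> = ennreal (measure_pmf.expectation p (\<lambda>x. c x E))"
      by (rule nn_integral_eq_integral [OF int nonneg])
    finally show "queries_in (Pow V) (cut_query E) (Sample (map_pmf A p)) \<and>
      zero_error (cut_query E) (Sample (map_pmf A p)) (spanning_forest E) \<and>
      0 \<le> measure_pmf.expectation p (\<lambda>x. c x E) \<and>
      expected_queries (cut_query E) (Sample (map_pmf A p)) \<le>
        ennreal (measure_pmf.expectation p (\<lambda>x. c x E))"
      using A E integral_nonneg_AE[OF nonneg]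
      by (fastforce simp: queries_in_def zero_error_def run_Sample simp del: run.simps(3))
  qed
qed

section \<open>Composite queries: batches and binary search\<close>

lemma solvable_edges_between:
  assumes \<E>: "\<And>E. E \<in> \<E> \<Longrightarrow> simple_graph V E"
    and AB: "A \<subseteq> V" "B \<subseteq> V" "A \<inter> B = {}"
    and s: "\<And>r. solvable V {E \<in> \<E>. edges_between E A B = r} c"
  shows "solvable V \<E> (\<lambda>E. 3 + c E)"
proof -
  have "solvable V \<E> (\<lambda>E. 1 + (1 + (1 + c E)))"
  proof (rule solvable_Query[of A], goal_cases)
    case (2 a)
    show ?case
    proof (rule solvable_Query[of B], goal_cases)
      case (2 b)
      show ?case
      proof (rule solvable_Query[of "A \<union> B"], goal_cases)
        case (2 ab)
        show ?case
        proof (rule solvable_mono[OF s[of "(a + b - ab) div 2"]])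
          fix E assume E: "E \<in> {E \<in> {E \<in> {E \<in> \<E>. cut_query E A = a}. cut_query E B = b}.
            cut_query E (A \<union> B) = ab}"
          then have "2 * edges_between E A B + ab = a + b"
            using edges_between_cut_query[OF \<E> AB(3), of E] by auto
          then have "2 * edges_between E A B = a + b - ab" by simp
          then show "E \<in> {E \<in> \<E>. edges_between E A B = (a + b - ab) div 2}"
            using E by auto
        qed simp
      qed (use AB in auto)
    qed (use AB in auto)
  qed (use AB in auto)
  then show ?thesis by (rule solvable_mono) auto
qed

lemma solvable_batch:
  assumes "finite I"
    and \<E>: "\<And>E. E \<in> \<E> \<Longrightarrow> simple_graph V E"
    and XY: "\<And>i. i \<in> I \<Longrightarrow> X i \<subseteq> V \<and> Y i \<subseteq> V \<and> X i \<inter> Y i = {}"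
    and s: "\<And>r. solvable V {E \<in> \<E>. \<forall>i\<in>I. edges_between E (X i) (Y i) = r i} c"
  shows "solvable V \<E> (\<lambda>E. 3 * real (card I) + c E)"
  using assms
proof (induction I arbitrary: \<E> c rule: finite_induct)
  case empty
  from empty.prems(3) show ?case by simp
next
  case (insert i I)
  have "solvable V \<E> (\<lambda>E. 3 * real (card I) + (3 + c E))"
  proof (rule insert.IH)
    fix r
    show "solvable V {E \<in> \<E>. \<forall>i\<in>I. edges_between E (X i) (Y i) = r i} (\<lambda>E. 3 + c E)"
    proof (rule solvable_edges_between[of _ _ "X i" "Y i"])
      fix r'
      show "solvable V {E \<in> {E \<in> \<E>. \<forall>i\<in>I. edges_between E (X i) (Y i) = r i}.
          edges_between E (X i) (Y i) = r'} c"
        by (rule solvable_mono[OF insert.prems(3)[of "r(i := r')"]]) (use insert.hyps in auto)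
    qed (use insert.prems in auto)
  qed (use insert.prems in auto)
  then show ?case by (rule solvable_mono) (use insert.hyps in auto)
qed

text \<open>Halving preserves the invariant that the candidate set has an edge to \<open>T\<close>:
  if the queried half has none, the other half must have one.\<close>

lemma solvable_search:
  assumes "finite X" "card X \<le> 2 ^ k"
    and \<E>: "\<And>E. E \<in> \<E> \<Longrightarrow> simple_graph V E"
    and XT: "X \<subseteq> V" "T \<subseteq> V" "X \<inter> T = {}"
    and pos: "\<And>E. E \<in> \<E> \<Longrightarrow> 0 < edges_between E X T"
    and s: "\<And>x. x \<in> X \<Longrightarrow> solvable V {E \<in> \<E>. 0 < edges_between E {x} T} c"
  shows "solvable V \<E> (\<lambda>E. 3 * real k + c E)"
  using assms
proof (induction k arbitrary: X \<E>)
  case 0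
  show ?case
  proof (cases "X = {}")
    case True
    then have "\<E> = {}" using 0(7) by (force simp: edges_between_def)
    then show ?thesis by (simp add: solvable_empty)
  next
    case False
    then have "card X = 1" using 0(1,2) by (simp add: le_Suc_eq)
    then obtain x where "X = {x}" by (auto simp: card_1_singleton_iff)
    then show ?thesis using 0(7) by (intro solvable_mono[OF 0(8)[of x]]) auto
  qed
next
  case (Suc k)
  obtain X1 where X1: "X1 \<subseteq> X" "card X1 = min (card X) (2 ^ k)"
    by (meson min.cobounded1 obtain_subset_with_card_n)
  have X2: "card (X - X1) \<le> 2 ^ k"
    using X1 Suc.prems(1,2) finite_subset[OF X1(1)] by (subst card_Diff_subset) auto
  have fin: "finite X1" "finite (X - X1)" using X1(1) Suc.prems(1) by (auto intro: finite_subset)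
  have "solvable V \<E> (\<lambda>E. 3 + (3 * real k + c E))"
  proof (rule solvable_edges_between[of _ _ X1 T])
    fix r
    show "solvable V {E \<in> \<E>. edges_between E X1 T = r} (\<lambda>E. 3 * real k + c E)"
    proof (cases "r = 0")
      case False
      show ?thesis
      proof (rule Suc.IH[OF fin(1)])
        fix x assume "x \<in> X1"
        then show "solvable V {E \<in> {E \<in> \<E>. edges_between E X1 T = r}. 0 < edges_between E {x} T} c"
          using X1(1) by (intro solvable_mono[OF Suc.prems(8)[of x]]) auto
      qed (use Suc.prems X1 False in auto)
    next
      case True
      show ?thesis
      proof (rule Suc.IH[OF fin(2) X2])
        fix E assume E: "E \<in> {E \<in> \<E>. edges_between E X1 T = r}"
        then have G: "simple_graph V E" using Suc.prems by auto
        show "0 < edges_between E (X - X1) T"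
          using E Suc.prems(7)[of E] True not_less_zero
          unfolding edges_between_pos_iff[OF G]
          using edges_between_pos_iff[OF G, of X1 T] by auto
      next
        fix x assume "x \<in> X - X1"
        then show "solvable V {E \<in> {E \<in> \<E>. edges_between E X1 T = r}. 0 < edges_between E {x} T} c"
          using X1(1) by (intro solvable_mono[OF Suc.prems(8)[of x]]) auto
      qed (use Suc.prems X1 in auto)
    qed
  qed (use Suc.prems X1 in auto)
  then show ?case by (rule solvable_mono) auto
qed

text \<open>Each piece has its own depth \<open>\<kappa> C\<close>, so that small pieces are charged
  little.\<close>

lemma solvable_search_all:
  assumes "finite \<C>"
    and \<E>: "\<And>E. E \<in> \<E> \<Longrightarrow> simple_graph V E"
    and CT: "\<And>C. C \<in> \<C> \<Longrightarrow> C \<subseteq> V \<and> C \<inter> T = {} \<and> card C \<le> 2 ^ \<kappa> C" and T: "T \<subseteq> V" "finite V"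
    and pos: "\<And>E C. E \<in> \<E> \<Longrightarrow> C \<in> \<C> \<Longrightarrow> 0 < edges_between E C T"
    and s: "\<And>u. (\<forall>C\<in>\<C>. u C \<in> C) \<Longrightarrow>
      solvable V {E \<in> \<E>. \<forall>C\<in>\<C>. 0 < edges_between E {u C} T} c"
  shows "solvable V \<E> (\<lambda>E. 3 * (\<Sum>C\<in>\<C>. real (\<kappa> C)) + c E)"
  using assms
proof (induction \<C> arbitrary: \<E> c rule: finite_induct)
  case empty
  from empty.prems(6) show ?case by simp
next
  case (insert C \<C>)
  have "solvable V \<E> (\<lambda>E. 3 * (\<Sum>C\<in>\<C>. real (\<kappa> C)) + (3 * real (\<kappa> C) + c E))"
  proof (rule insert.IH)
    fix u assume u: "\<forall>C\<in>\<C>. u C \<in> C"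
    show "solvable V {E \<in> \<E>. \<forall>C\<in>\<C>. 0 < edges_between E {u C} T} (\<lambda>E. 3 * real (\<kappa> C) + c E)"
    proof (rule solvable_search[of C])
      fix x assume x: "x \<in> C"
      have "solvable V {E \<in> \<E>. \<forall>D\<in>insert C \<C>. 0 < edges_between E {(u(C := x)) D} T} c"
        by (rule insert.prems(6)) (use u x in auto)
      then show "solvable V {E \<in> {E \<in> \<E>. \<forall>C\<in>\<C>. 0 < edges_between E {u C} T}.
          0 < edges_between E {x} T} c"
        by (rule solvable_mono) (use insert.hyps in auto)
    next
      show "finite C" using insert.prems(2)[of C] \<open>finite V\<close> by (auto intro: finite_subset)
    qed (use insert.prems in auto)
  qed (use insert.prems in auto)
  then show ?case by (rule solvable_mono) (use insert.hyps in auto)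
qed

section \<open>Coin weighing\<close>

text \<open>
  The coins that \<open>2 ^ k\<close> signed weighings can handle. The recursion comes from replacing weighings
  \<open>a\<close> and \<open>b\<close> of two separate groups of coins by \<open>a + b + z\<close> and \<open>a - b\<close>, where \<open>z\<close> is
  one additional coin: parity reveals \<open>z\<close>, after which \<open>a\<close> and \<open>b\<close> can be solved for.
\<close>

primrec coins :: "nat \<Rightarrow> nat" where
  "coins 0 = 1"
| "coins (Suc k) = 2 * coins k + 2 ^ k"

text \<open>So each of the \<open>2 ^ k\<close> weighings accounts for \<open>(k + 2) / 2\<close>
  coins, which is the source of the logarithmic saving.\<close>

lemma coins_eq: "2 * coins k = (k + 2) * 2 ^ k"
  by (induction k) (auto simp: algebra_simps)

lemma coins_pos: "0 < coins k"
  by (induction k) auto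

lemma sum_diff_parity:
  fixes a b a' b' :: int and z z' :: nat
  assumes "a + b + int z = a' + b' + int z'" "a - b = a' - b'" "z \<le> 1" "z' \<le> 1"
  shows "a = a' \<and> b = b' \<and> z = z'"
  using assms by presburger

text \<open>Entries are confined to -1, 0 and 1 so that each weighing can be replaced by two subset
  counts. Fewer than \<open>coins k\<close> coins are allowed, hence the minima in the sizes of the
  two groups.\<close>

lemma signed_weighings:
  assumes "finite S" "card S \<le> coins k"
  shows "\<exists>a :: nat \<Rightarrow> 'a \<Rightarrow> int. (\<forall>i x. a i x \<in> {-1, 0, 1}) \<and>
    (\<forall>X Y. X \<subseteq> S \<longrightarrow> Y \<subseteq> S \<longrightarrow> (\<forall>i < 2 ^ k. sum (a i) X = sum (a i) Y) \<longrightarrow> X = Y)"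
  using assms
proof (induction k arbitrary: S)
  case 0
  show ?case
  proof (rule exI[of _ "\<lambda>_ _. 1"], intro conjI allI impI)
    fix X Y assume XY: "X \<subseteq> S" "Y \<subseteq> S" "\<forall>i < (2 :: nat) ^ 0. sum (\<lambda>_. 1 :: int) X = sum (\<lambda>_. 1) Y"
    then have eq: "card X = card Y" by simp
    have fin: "finite X" "finite Y" using XY 0(1) by (auto intro: finite_subset)
    obtain x where "S \<subseteq> {x}" using 0 by (auto simp: le_Suc_eq card_1_singleton_iff)
    then have "X \<in> {{}, {x}}" "Y \<in> {{}, {x}}" using XY by auto
    then show "X = Y" using eq by auto
  qed simp
next
  case (Suc k)
  obtain S1 where S1: "S1 \<subseteq> S" "card S1 = min (card S) (coins k)"
    by (meson min.cobounded1 obtain_subset_with_card_n)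
  obtain S2 where S2: "S2 \<subseteq> S - S1" "card S2 = min (card (S - S1)) (coins k)"
    by (meson min.cobounded1 obtain_subset_with_card_n)
  define Z where "Z = S - S1 - S2"
  have fin: "finite S1" "finite S2" "finite Z"
    using S1 S2 Suc.prems(1) by (auto simp: Z_def intro: finite_subset)
  have "card Z = card S - card S1 - card S2"
    using fin S1 S2 Suc.prems(1) by (simp add: Z_def card_Diff_subset)
  moreover have "card (S - S1) = card S - card S1"
    using fin S1 by (simp add: card_Diff_subset)
  moreover have "z \<le> p" if "z = s - s1 - s2" "d = s - s1" "s1 = min s c" "s2 = min d c"
    "s \<le> 2 * c + p" for z s s1 s2 d c p :: nat
    using that by linarith
  ultimately have "card Z \<le> 2 ^ k" using S1(2) S2(2) Suc.prems(2) unfolding coins.simps by blast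
  moreover obtain e where e: "bij_betw e Z {0..<card Z}"
    using ex_bij_betw_finite_nat[OF fin(3)] by blast
  ultimately have e_less: "e x < 2 ^ k" if "x \<in> Z" for x
    using bij_betwE[OF e] that by fastforce
  have e_inj: "inj_on e Z" using e by (rule bij_betw_imp_inj_on)
  have "card S1 \<le> coins k" using S1(2) by simp
  from Suc.IH[OF fin(1) this] obtain a :: "nat \<Rightarrow> 'a \<Rightarrow> int"
    where a: "\<forall>i x. a i x \<in> {-1, 0, 1 :: int}"
    "\<forall>X Y. X \<subseteq> S1 \<longrightarrow> Y \<subseteq> S1 \<longrightarrow> (\<forall>i < 2 ^ k. sum (a i) X = sum (a i) Y) \<longrightarrow> X = Y"
    by (elim exE conjE)
  have "card S2 \<le> coins k" using S2(2) by simp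
  from Suc.IH[OF fin(2) this] obtain b :: "nat \<Rightarrow> 'a \<Rightarrow> int"
    where b: "\<forall>i x. b i x \<in> {-1, 0, 1 :: int}"
    "\<forall>X Y. X \<subseteq> S2 \<longrightarrow> Y \<subseteq> S2 \<longrightarrow> (\<forall>i < 2 ^ k. sum (b i) X = sum (b i) Y) \<longrightarrow> X = Y"
    by (elim exE conjE)
  \<comment> \<open>The first \<open>2 ^ k\<close> rows are a + b + z, the others a - b. A surplus
    coin \<open>x\<close> takes part only in row \<open>e x\<close>; as \<open>e\<close> is
    injective on \<open>Z\<close> with values below \<open>2 ^ k\<close>, no row contains two
    surplus coins.\<close>
  define c where "c i x = (if i < 2 ^ k then
      (if x \<in> S1 then a i x else if x \<in> S2 then b i x else if e x = i then 1 else 0)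
    else (if x \<in> S1 then a (i - 2 ^ k) x else if x \<in> S2 then - b (i - 2 ^ k) x else 0))" for i x
  have split: "sum (c i) X = sum (c i) (X \<inter> S1) + sum (c i) (X \<inter> S2) + sum (c i) (X \<inter> Z)"
    if "X \<subseteq> S" for X i
  proof -
    have "X = X \<inter> S1 \<union> X \<inter> S2 \<union> X \<inter> Z" using that by (auto simp: Z_def)
    then have "sum (c i) X = sum (c i) (X \<inter> S1 \<union> X \<inter> S2 \<union> X \<inter> Z)" by simp
    also have "\<dots> = sum (c i) (X \<inter> S1) + sum (c i) (X \<inter> S2) + sum (c i) (X \<inter> Z)"
      using fin S2 by (subst sum.union_disjoint; (subst sum.union_disjoint)?) (auto simp: Z_def)
    finally show ?thesis .
  qed
  have plus: "sum (c i) X = sum (a i) (X \<inter> S1) + sum (b i) (X \<inter> S2) + int (card {x \<in> X \<inter> Z. e x = i})"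
    if "X \<subseteq> S" "i < 2 ^ k" for X i
  proof -
    have "sum (c i) (X \<inter> S1) = sum (a i) (X \<inter> S1)" "sum (c i) (X \<inter> S2) = sum (b i) (X \<inter> S2)"
      using that S2 by (auto simp: c_def intro!: sum.cong)
    moreover have "sum (c i) (X \<inter> Z) = (\<Sum>x \<in> X \<inter> Z. if e x = i then 1 else 0)"
      using that by (intro sum.cong) (auto simp: c_def Z_def)
    ultimately show ?thesis using fin by (simp add: split[OF that(1)] sum.If_cases Int_def)
  qed
  have minus: "sum (c (2 ^ k + i)) X = sum (a i) (X \<inter> S1) - sum (b i) (X \<inter> S2)"
    if "X \<subseteq> S" for X i
  proof -
    have "sum (c (2 ^ k + i)) (X \<inter> S1) = sum (a i) (X \<inter> S1)" by (auto simp: c_def intro!: sum.cong)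
    moreover have "sum (c (2 ^ k + i)) (X \<inter> S2) = - sum (b i) (X \<inter> S2)"
      using S2 by (subst sum_negf [symmetric]) (auto simp: c_def intro!: sum.cong)
    moreover have "sum (c (2 ^ k + i)) (X \<inter> Z) = 0" by (auto simp: c_def Z_def intro!: sum.neutral)
    ultimately show ?thesis by (simp add: split[OF that])
  qed
  have le1: "card {x \<in> X \<inter> Z. e x = i} \<le> 1" for X i
  proof (rule card_le_Suc0_iff_eq[THEN iffD2, simplified One_nat_def [symmetric]])
    show "finite {x \<in> X \<inter> Z. e x = i}" using fin by simp
  qed (use e_inj in \<open>auto simp: inj_on_def\<close>)
  show ?case
  proof (rule exI[of _ c], intro conjI allI impI)
    fix i x show "c i x \<in> {-1, 0, 1}" 
      using a(1)[rule_format, of i x] a(1)[rule_format, of "i - 2 ^ k" x]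
        b(1)[rule_format, of i x] b(1)[rule_format, of "i - 2 ^ k" x]
      by (auto simp: c_def)
  next
    fix X Y assume X: "X \<subseteq> S" and Y: "Y \<subseteq> S" and eq: "\<forall>i < 2 ^ Suc k. sum (c i) X = sum (c i) Y"
    have *: "sum (a i) (X \<inter> S1) = sum (a i) (Y \<inter> S1) \<and> sum (b i) (X \<inter> S2) = sum (b i) (Y \<inter> S2) \<and>
        card {x \<in> X \<inter> Z. e x = i} = card {x \<in> Y \<inter> Z. e x = i}" if "i < 2 ^ k" for i
    proof -
      have "sum (c i) X = sum (c i) Y" "sum (c (2 ^ k + i)) X = sum (c (2 ^ k + i)) Y"
        using eq that by auto
      then show ?thesis
        unfolding plus[OF X that] plus[OF Y that] minus[OF X] minus[OF Y]
        by (intro sum_diff_parity le1)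
    qed
    have "X \<inter> S1 = Y \<inter> S1" using a(2)[rule_format, of "X \<inter> S1" "Y \<inter> S1"] * by blast
    moreover have "X \<inter> S2 = Y \<inter> S2" using b(2)[rule_format, of "X \<inter> S2" "Y \<inter> S2"] * by blast
    moreover have "x \<in> X \<longleftrightarrow> x \<in> Y" if "x \<in> Z" for x
    proof -
      have mem: "x \<in> U \<longleftrightarrow> card {y \<in> U \<inter> Z. e y = e x} = 1" for U
      proof (cases "x \<in> U")
        case True
        then have "{y \<in> U \<inter> Z. e y = e x} = {x}" using e_inj that by (auto simp: inj_on_def)
        then have "card {y \<in> U \<inter> Z. e y = e x} = 1" by (simp only: card.insert card.empty) simp
        then show ?thesis using True by blast
      next
        case False
        then have "{y \<in> U \<inter> Z. e y = e x} = {}" using e_inj that by (auto simp: inj_on_def)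
        then have "card {y \<in> U \<inter> Z. e y = e x} = 0" by (simp only: card.empty)
        then show ?thesis using False by linarith
      qed
      have "card {y \<in> X \<inter> Z. e y = e x} = card {y \<in> Y \<inter> Z. e y = e x}"
        using *[OF e_less[OF that]] by blast
      then show ?thesis unfolding mem by (rule arg_cong)
    qed
    ultimately show "X = Y" using X Y unfolding Z_def by blast
  qed
qed

text \<open>The set-family form of a detecting matrix from the coin-weighing problem: intersection
  sizes, which edge counts can supply, determine the subset.\<close>

definition detecting :: "'a set \<Rightarrow> 'a set set \<Rightarrow> bool" where
  "detecting S \<A> \<longleftrightarrow> finite \<A> \<and> \<A> \<subseteq> Pow S \<and>
     (\<forall>X Y. X \<subseteq> S \<longrightarrow> Y \<subseteq> S \<longrightarrow> (\<forall>A\<in>\<A>. card (X \<inter> A) = card (Y \<inter> A)) \<longrightarrow> X = Y)"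

lemma detectingD:
  assumes "detecting S \<A>" "X \<subseteq> S" "Y \<subseteq> S" "\<And>A. A \<in> \<A> \<Longrightarrow> card (X \<inter> A) = card (Y \<inter> A)"
  shows "X = Y"
proof -
  have "\<forall>X Y. X \<subseteq> S \<longrightarrow> Y \<subseteq> S \<longrightarrow> (\<forall>A\<in>\<A>. card (X \<inter> A) = card (Y \<inter> A)) \<longrightarrow> X = Y"
    using assms(1) unfolding detecting_def by (elim conjE)
  from this[rule_format, OF assms(2,3)] assms(4) show ?thesis by simp
qed

text \<open>A signed weighing is the difference of the counts on its +1 part and its -1 part; taking
  both counts doubles the number of weighings.\<close>

lemma detecting_block:
  assumes "finite S" "card S \<le> coins k"
  shows "\<exists>\<A>. detecting S \<A> \<and> card \<A> \<le> 2 ^ (k + 1)"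
proof -
  from signed_weighings[OF assms] obtain a :: "nat \<Rightarrow> 'a \<Rightarrow> int"
    where a: "\<forall>i x. a i x \<in> {-1, 0, 1}"
      "\<forall>X Y. X \<subseteq> S \<longrightarrow> Y \<subseteq> S \<longrightarrow> (\<forall>i < 2 ^ k. sum (a i) X = sum (a i) Y) \<longrightarrow> X = Y"
    by (elim exE conjE)
  define pos where "pos i = {x \<in> S. a i x = 1}" for i
  define neg where "neg i = {x \<in> S. a i x = -1}" for i
  define \<A> where "\<A> = pos ` {..<2 ^ k} \<union> neg ` {..<2 ^ k}"
  have sum: "sum (a i) X = int (card (X \<inter> pos i)) - int (card (X \<inter> neg i))" if "X \<subseteq> S" for X i
  proof -
    have finX: "finite X" using that assms(1) by (rule finite_subset)
    have "sum (a i) X = (\<Sum>x\<in>X. (if x \<in> pos i then 1 else 0) - (if x \<in> neg i then 1 else 0))"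
    proof (rule sum.cong)
      fix x assume "x \<in> X"
      then show "a i x = (if x \<in> pos i then 1 else 0) - (if x \<in> neg i then 1 else 0)"
        using that a(1)[rule_format, of i x] by (auto simp: pos_def neg_def)
    qed simp
    then show ?thesis using finX by (simp add: sum_subtractf sum.If_cases)
  qed
  have "detecting S \<A>"
    unfolding detecting_def
  proof (intro conjI allI impI)
    fix X Y assume X: "X \<subseteq> S" and Y: "Y \<subseteq> S" and eq: "\<forall>A\<in>\<A>. card (X \<inter> A) = card (Y \<inter> A)"
    have "sum (a i) X = sum (a i) Y" if "i < 2 ^ k" for i
    proof -
      have "pos i \<in> \<A>" "neg i \<in> \<A>" using that by (auto simp: \<A>_def)
      then show ?thesis unfolding sum[OF X] sum[OF Y] using eq by simp
    qed
    then show "X = Y" using a(2)[rule_format, OF X Y] by blast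
  qed (auto simp: \<A>_def pos_def neg_def)
  moreover have "card \<A> \<le> 2 ^ (k + 1)"
  proof -
    have "card \<A> \<le> card (pos ` {..<2 ^ k}) + card (neg ` {..<2 ^ k})"
      unfolding \<A>_def by (rule card_Un_le)
    also have "\<dots> \<le> 2 ^ k + 2 ^ k"
      using card_image_le[of "{..<2 ^ k}" pos] card_image_le[of "{..<2 ^ k}" neg]
      by (simp add: add_mono)
    finally show ?thesis by simp
  qed
  ultimately show ?thesis by blast
qed

lemma detecting_Un:
  fixes S1 S2 :: "'a set"
  assumes 1: "detecting S1 \<A>1" and 2: "detecting S2 \<A>2"
  shows "detecting (S1 \<union> S2) (\<A>1 \<union> \<A>2)"
proof -
  have "X = Y" if X: "X \<subseteq> S1 \<union> S2" and Y: "Y \<subseteq> S1 \<union> S2"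
    and eq: "\<forall>A\<in>\<A>1 \<union> \<A>2. card (X \<inter> A) = card (Y \<inter> A)" for X Y
  proof -
    have part: "X \<inter> S = Y \<inter> S" if S: "detecting S \<A>" and sub: "\<A> \<subseteq> \<A>1 \<union> \<A>2" for S \<A>
    proof (rule detectingD[OF S])
      fix A assume A: "A \<in> \<A>"
      then have SA: "S \<inter> A = A" using S unfolding detecting_def by fast
      have "card (X \<inter> A) = card (Y \<inter> A)" using A sub eq by blast
      then show "card (X \<inter> S \<inter> A) = card (Y \<inter> S \<inter> A)" by (simp only: Int_assoc SA)
    qed (rule Int_lower2)+
    have "X \<inter> S1 = Y \<inter> S1" by (rule part[OF 1]) simp
    moreover have "X \<inter> S2 = Y \<inter> S2" by (rule part[OF 2]) simp
    ultimately show "X = Y" using X Y by blast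
  qed
  moreover have "finite (\<A>1 \<union> \<A>2)" "\<A>1 \<union> \<A>2 \<subseteq> Pow (S1 \<union> S2)"
    using 1 2 unfolding detecting_def by fast+
  ultimately show ?thesis unfolding detecting_def by (intro conjI allI impI)
qed

text \<open>\<open>S\<close> is cut into blocks of at most \<open>coins k\<close> elements. The
  \<open>+ 1\<close> pays for the last, partly filled block and is the origin of the lower-order
  term in the final bound.\<close>

lemma detecting_exists:
  assumes "finite S"
  shows "\<exists>\<A>. detecting S \<A> \<and> card \<A> \<le> (card S div coins k + 1) * 2 ^ (k + 1)"
proof -
  have "\<exists>\<A>. detecting S \<A> \<and> card \<A> \<le> m * 2 ^ (k + 1)" if "card S \<le> m * coins k" for m
    using assms that
  proof (induction m arbitrary: S)
    case 0
    then show ?case by (intro exI[of _ "{}"]) (simp add: detecting_def)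
  next
    case (Suc m)
    obtain T where T: "T \<subseteq> S" "card T = min (card S) (coins k)"
      by (meson min.cobounded1 obtain_subset_with_card_n)
    have fin: "finite T" "finite (S - T)" using T Suc.prems by (auto intro: finite_subset)
    have "card (S - T) \<le> m * coins k" using T fin Suc.prems(2) by (simp add: card_Diff_subset)
    then obtain \<A> where \<A>: "detecting (S - T) \<A>" "card \<A> \<le> m * 2 ^ (k + 1)"
      using Suc.IH fin by blast
    obtain \<B> where \<B>: "detecting T \<B>" "card \<B> \<le> 2 ^ (k + 1)"
      using detecting_block[of T k] fin T by auto
    have "detecting S (\<A> \<union> \<B>)"
      using detecting_Un[OF \<A>(1) \<B>(1)] T(1) by (simp add: Un_absorb2)
    moreover have "card (\<A> \<union> \<B>) \<le> Suc m * 2 ^ (k + 1)"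
      using card_Un_le[of \<A> \<B>] \<A>(2) \<B>(2) by simp
    ultimately show ?case by blast
  qed
  moreover have "card S \<le> (card S div coins k + 1) * coins k"
    using dividend_less_times_div[OF coins_pos, of "card S" k] by (simp add: algebra_simps)
  ultimately show ?thesis by blast
qed

section \<open>Identifying unique neighbours bit by bit\<close>

lemma binary_separation:
  assumes "finite V" "card V \<le> 2 ^ b"
  shows "\<exists>B :: nat \<Rightarrow> 'a set. \<forall>x\<in>V. \<forall>y\<in>V. (\<forall>j<b. x \<in> B j \<longleftrightarrow> y \<in> B j) \<longrightarrow> x = y"
proof -
  obtain e where e: "bij_betw e V {0..<card V}"
    using ex_bij_betw_finite_nat[OF assms(1)] by blast
  show ?thesis
  proof (intro exI[of _ "\<lambda>j. {x. bit (e x) j}"] ballI impI)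
    fix x y assume xy: "x \<in> V" "y \<in> V" "\<forall>j<b. x \<in> {x. bit (e x) j} \<longleftrightarrow> y \<in> {x. bit (e x) j}"
    have "take_bit b (e x) = take_bit b (e y)"
      using xy(3) by (intro bit_eqI) (auto simp: bit_take_bit_iff)
    moreover have "e x < 2 ^ b" "e y < 2 ^ b" using bij_betwE[OF e] xy assms(2) by fastforce+
    ultimately have "e x = e y" by (simp add: take_bit_nat_eq_self)
    then show "x = y" using e xy by (auto simp: bij_betw_def inj_on_def)
  qed
qed

lemma edges_between_singleton: "edges_between E {u} R = card {w \<in> R. {u, w} \<in> E}"
proof -
  have "{(x, y). x \<in> {u} \<and> y \<in> R \<and> {x, y} \<in> E} = Pair u ` {w \<in> R. {u, w} \<in> E}" by auto
  then show ?thesis by (simp add: edges_between_def card_image inj_on_def)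
qed

text \<open>Since every \<open>u\<close> in \<open>S\<close> has just one neighbour in
  \<open>R\<close>, the edges between \<open>A\<close> and \<open>R \<inter> B j\<close> correspond
  to the members of \<open>A\<close> whose neighbour has bit \<open>j\<close> set. An edge count
  thus weighs the \<open>j\<close>-th bit vector with \<open>A\<close>, and one detecting family
  serves all \<open>b\<close> bits.\<close>

lemma solvable_identify:
  fixes V :: "'v set"
  assumes V: "finite V" "card V \<le> 2 ^ b"
    and \<E>: "\<And>E. E \<in> \<E> \<Longrightarrow> simple_graph V E"
    and SR: "S \<subseteq> V" "R \<subseteq> V" "S \<inter> R = {}"
    and one: "\<And>E u. E \<in> \<E> \<Longrightarrow> u \<in> S \<Longrightarrow> edges_between E {u} R = 1"
    and s: "\<And>\<phi>. (\<forall>u\<in>S. \<phi> u \<in> R) \<Longrightarrow> solvable V {E \<in> \<E>. \<forall>u\<in>S. {u, \<phi> u} \<in> E} c"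
  shows "solvable V \<E> (\<lambda>E. real (3 * b * ((card S div coins k + 1) * 2 ^ (k + 1))) + c E)"
proof -
  have finS: "finite S" using SR V finite_subset by blast
  obtain \<A> where \<A>: "detecting S \<A>" "card \<A> \<le> (card S div coins k + 1) * 2 ^ (k + 1)"
    using detecting_exists[OF finS] by blast
  obtain B :: "nat \<Rightarrow> 'v set" where
    B: "\<And>x y. x \<in> V \<Longrightarrow> y \<in> V \<Longrightarrow> (\<And>j. j < b \<Longrightarrow> x \<in> B j \<longleftrightarrow> y \<in> B j) \<Longrightarrow> x = y"
    using binary_separation[OF V] by metis
  have \<A>': "finite \<A>" "\<And>A. A \<in> \<A> \<Longrightarrow> A \<subseteq> S"
    using \<A>(1) unfolding detecting_def by fast+
  define nb where "nb E u = (THE w. {w \<in> R. {u, w} \<in> E} = {w})" for E u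
  have nb: "{w \<in> R. {u, w} \<in> E} = {nb E u}" if Eu: "E \<in> \<E>" "u \<in> S" for E u
  proof -
    obtain w where "{w \<in> R. {u, w} \<in> E} = {w}"
      using one[OF Eu] unfolding edges_between_singleton One_nat_def card_1_singleton_iff by blast
    then show ?thesis unfolding nb_def by simp
  qed
  have count: "edges_between E A (R \<inter> B j) = card ({u \<in> S. nb E u \<in> B j} \<inter> A)"
    if "E \<in> \<E>" "A \<subseteq> S" for E A j
  proof -
    have "{(x, y). x \<in> A \<and> y \<in> R \<inter> B j \<and> {x, y} \<in> E} =
        (\<lambda>u. (u, nb E u)) ` ({u \<in> S. nb E u \<in> B j} \<inter> A)"
    proof -
      have "w \<in> R \<and> {u, w} \<in> E \<longleftrightarrow> w = nb E u" if "u \<in> A" for u w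
        using nb[of E u] \<open>E \<in> \<E>\<close> \<open>A \<subseteq> S\<close> that by (simp add: set_eq_iff subset_iff)
      then show ?thesis using \<open>A \<subseteq> S\<close> by (force simp: subset_iff)
    qed
    then show ?thesis by (simp add: edges_between_def card_image inj_on_def)
  qed
  have "solvable V \<E> (\<lambda>E. 3 * real (card (\<A> \<times> {..<b})) + c E)"
  proof (rule solvable_batch[where X = fst and Y = "\<lambda>p. R \<inter> B (snd p)"])
    fix r
    let ?\<E> = "{E \<in> \<E>. \<forall>p\<in>\<A> \<times> {..<b}. edges_between E (fst p) (R \<inter> B (snd p)) = r p}"
    show "solvable V ?\<E> c"
    proof (cases "?\<E> = {}")
      case True
      then show ?thesis by (simp only: solvable_empty)
    next
      case False
      \<comment> \<open>Any consistent graph decodes the answers: all graphs of the class agree with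
        \<open>E0\<close> on the neighbours, so \<open>nb E0\<close> is a map known to the
        algorithm.\<close>
      then obtain E0 where E0: "E0 \<in> ?\<E>" by blast
      have same: "nb E u = nb E0 u" if E: "E \<in> ?\<E>" and u: "u \<in> S" for E u
      proof (rule B)
        have eq: "{u \<in> S. nb E u \<in> B j} = {u \<in> S. nb E0 u \<in> B j}" if "j < b" for j
        proof (rule detectingD[OF \<A>(1)])
          fix A assume A: "A \<in> \<A>"
          have "edges_between E A (R \<inter> B j) = r (A, j)" "edges_between E0 A (R \<inter> B j) = r (A, j)"
            using E E0 A that by auto
          moreover have "E \<in> \<E>" "E0 \<in> \<E>" using E E0 by auto
          ultimately show "card ({u \<in> S. nb E u \<in> B j} \<inter> A) = card ({u \<in> S. nb E0 u \<in> B j} \<inter> A)"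
            using count[of E A j] count[of E0 A j] \<A>'(2)[OF A] by simp
        qed auto
        show "nb E u \<in> B j \<longleftrightarrow> nb E0 u \<in> B j" if "j < b" for j using eq[OF that] u by auto
        show "nb E u \<in> V" "nb E0 u \<in> V" using nb[of E u] nb[of E0 u] E E0 u SR by auto
      qed
      show ?thesis
      proof (rule solvable_mono[OF s[of "nb E0"]])
        show "\<forall>u\<in>S. nb E0 u \<in> R" using nb[of E0] E0 by blast
        fix E assume E: "E \<in> ?\<E>"
        then show "E \<in> {E \<in> \<E>. \<forall>u\<in>S. {u, nb E0 u} \<in> E}"
          using same[OF E] nb[of E] by auto
      qed simp
    qed
  next
    show "fst p \<subseteq> V \<and> R \<inter> B (snd p) \<subseteq> V \<and> fst p \<inter> (R \<inter> B (snd p)) = {}"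
      if "p \<in> \<A> \<times> {..<b}" for p
      using that \<A>'(2)[of "fst p"] SR by (auto simp: subset_iff disjoint_iff)
  qed (use \<A>'(1) \<E> in auto)
  then show ?thesis
  proof (rule solvable_mono)
    fix E
    have "3 * card (\<A> \<times> {..<b}) \<le> 3 * b * ((card S div coins k + 1) * 2 ^ (k + 1))"
      using mult_left_mono[OF \<A>(2), of "3 * b"] by (simp add: card_cartesian_product mult_ac)
    then have "real (3 * card (\<A> \<times> {..<b})) \<le> real (3 * b * ((card S div coins k + 1) * 2 ^ (k + 1)))"
      by (rule of_nat_mono)
    then show "3 * real (card (\<A> \<times> {..<b})) + c E \<le>
        real (3 * b * ((card S div coins k + 1) * 2 ^ (k + 1))) + c E"
      by simp
  qed
qed

text \<open>Endpoints at different scales have their unique neighbours in different samples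
  \<open>R (\<sigma> u)\<close>, so each scale gets its own weighings and pays separately for
  rounding up to full blocks.\<close>

lemma solvable_identify_scales:
  fixes V :: "'v set" and \<sigma> :: "'v \<Rightarrow> nat"
  assumes V: "finite V" "card V \<le> 2 ^ b"
    and "\<And>E. E \<in> \<E> \<Longrightarrow> simple_graph V E"
    and "S \<subseteq> V" "\<And>i. R i \<subseteq> T" "T \<subseteq> V" "S \<inter> T = {}" "\<And>u. u \<in> S \<Longrightarrow> \<sigma> u < q"
    and "\<And>E u. E \<in> \<E> \<Longrightarrow> u \<in> S \<Longrightarrow> edges_between E {u} (R (\<sigma> u)) = 1"
    and "\<And>\<phi>. (\<forall>u\<in>S. \<phi> u \<in> T) \<Longrightarrow> solvable V {E \<in> \<E>. \<forall>u\<in>S. {u, \<phi> u} \<in> E} c"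
  shows "solvable V \<E> (\<lambda>E. (\<Sum>i<q.
    real (3 * b * ((card {u \<in> S. \<sigma> u = i} div coins k + 1) * 2 ^ (k + 1)))) + c E)"
  using assms(3-)
proof (induction q arbitrary: S \<E> c)
  case 0
  then have S: "S = {}" by auto
  show ?case using 0(8)[of id] unfolding S by simp
next
  case (Suc q)
  let ?f = "\<lambda>i S. real (3 * b * ((card {u \<in> S. \<sigma> u = i} div coins k + 1) * 2 ^ (k + 1)))"
  let ?S = "{u \<in> S. \<sigma> u < q}" and ?S' = "{u \<in> S. \<sigma> u = q}"
  have "solvable V \<E> (\<lambda>E. (\<Sum>i<q. ?f i ?S) + (?f q S + c E))"
  proof (rule Suc.IH)
    fix \<phi> assume \<phi>: "\<forall>u\<in>?S. \<phi> u \<in> T"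
    show "solvable V {E \<in> \<E>. \<forall>u\<in>?S. {u, \<phi> u} \<in> E} (\<lambda>E. ?f q S + c E)"
    proof (rule solvable_identify[OF V, where R = "R q"])
      fix \<psi> assume \<psi>: "\<forall>u\<in>?S'. \<psi> u \<in> R q"
      let ?\<phi> = "\<lambda>u. if \<sigma> u = q then \<psi> u else \<phi> u"
      have 1: "\<forall>u\<in>S. ?\<phi> u \<in> T" using \<phi> \<psi> Suc.prems(3,6) by (fastforce simp: less_Suc_eq)
      show "solvable V {E \<in> {E \<in> \<E>. \<forall>u\<in>?S. {u, \<phi> u} \<in> E}. \<forall>u\<in>?S'. {u, \<psi> u} \<in> E} c"
        by (rule solvable_mono[OF Suc.prems(8)[OF 1]])
           (use Suc.prems(6) in \<open>auto simp: less_Suc_eq\<close>)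
    next
      fix E u assume "E \<in> {E \<in> \<E>. \<forall>u\<in>?S. {u, \<phi> u} \<in> E}" "u \<in> ?S'"
      then show "edges_between E {u} (R q) = 1" using Suc.prems(7)[of E u] by auto
    next
      show "?S' \<subseteq> V" "?S' \<inter> R q = {}" using Suc.prems(2,3,5) by auto
      show "R q \<subseteq> V" using Suc.prems(3,4) by (rule order_trans)
      show "simple_graph V E" if "E \<in> {E \<in> \<E>. \<forall>u\<in>?S. {u, \<phi> u} \<in> E}" for E
        using that Suc.prems(1) by simp
    qed
  next
    show "?S \<subseteq> V" "?S \<inter> T = {}" using Suc.prems(2,5) by auto
    show "simple_graph V E" if "E \<in> \<E>" for E using that by (rule Suc.prems(1))
    show "edges_between E {u} (R (\<sigma> u)) = 1" if "E \<in> \<E>" "u \<in> ?S" for E u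
      using that Suc.prems(7) by simp
    show "R i \<subseteq> T" for i by (rule Suc.prems(3))
  qed (use Suc.prems(4) in simp_all)
  moreover have "{u \<in> ?S. \<sigma> u = i} = {u \<in> S. \<sigma> u = i}" if "i < q" for i using that by auto
  ultimately show ?case by (simp add: add.assoc)
qed

section \<open>Partial spanning forests\<close>

abbreviation connected_in :: "'v set set \<Rightarrow> ('v \<times> 'v) set" where
  "connected_in F \<equiv> (adjacency F)\<^sup>*"

lemma connected_in_sym: "(x, y) \<in> connected_in F \<Longrightarrow> (y, x) \<in> connected_in F"
  by (rule symD[OF sym_rtrancl]) (auto simp: sym_def adjacency_def insert_commute)

lemma connected_in_insert:
  "connected_in (insert {u, w} F) = connected_in F \<union>
     {(x, y). (x, u) \<in> connected_in F \<and> (w, y) \<in> connected_in F} \<union>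
     {(x, y). (x, w) \<in> connected_in F \<and> (u, y) \<in> connected_in F}"
proof -
  have "adjacency (insert {u, w} F) = insert (u, w) (insert (w, u) (adjacency F))"
    by (auto simp: adjacency_def doubleton_eq_iff)
  then show ?thesis
    by (simp add: rtrancl_insert) (blast intro: rtrancl_trans)
qed

text \<open>A new cycle must use \<open>{u, w}\<close>, and at only one position \<open>i\<close>.
  Walking around the rest of the cycle then connects \<open>u\<close> and \<open>w\<close> inside
  \<open>F\<close>.\<close>

lemma acyclic_edges_insert:
  assumes F: "acyclic_edges F" and uw: "(u, w) \<notin> connected_in F"
  shows "acyclic_edges (insert {u, w} F)"
  unfolding acyclic_edges_def
proof
  assume "\<exists>vs. cycle (insert {u, w} F) vs"
  then obtain vs where vs: "cycle (insert {u, w} F) vs" by blast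
  define n where "n = length vs"
  have n: "3 \<le> n" and dist: "distinct vs"
    and edge: "\<And>i. i < n \<Longrightarrow> {vs ! i, vs ! (Suc i mod n)} \<in> insert {u, w} F"
    using vs by (auto simp: cycle_def n_def)
  obtain i where i: "i < n" "{vs ! i, vs ! (Suc i mod n)} \<notin> F"
    using F n dist unfolding acyclic_edges_def cycle_def n_def by blast
  then have iuw: "{vs ! i, vs ! (Suc i mod n)} = {u, w}" using edge by blast
  have other: "{vs ! j, vs ! (Suc j mod n)} \<in> F" if j: "j < n" "j \<noteq> i" for j
  proof -
    have idx: "vs ! a = vs ! b \<longleftrightarrow> a = b" if "a < n" "b < n" for a b
      using that dist by (simp add: n_def nth_eq_iff_index_eq)
    \<comment> \<open>Here \<open>3 \<le> n\<close> matters: around two vertices both positions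
      would carry the same edge.\<close>
    have "{vs ! j, vs ! (Suc j mod n)} \<noteq> {vs ! i, vs ! (Suc i mod n)}"
      using i j n by (auto simp: doubleton_eq_iff idx mod_Suc split: if_splits)
    then show ?thesis using edge[OF j(1)] iuw by auto
  qed
  have path: "(vs ! (Suc i mod n), vs ! ((Suc i + k) mod n)) \<in> connected_in F" if "k < n" for k
    using that
  proof (induction k)
    case (Suc k)
    let ?j = "(Suc i + k) mod n"
    have "?j \<noteq> i" using Suc.prems i(1) by (cases "Suc i + k < n") (auto simp: le_mod_geq)
    moreover have "?j < n" using n by simp
    ultimately have "{vs ! ?j, vs ! (Suc ?j mod n)} \<in> F" using other by blast
    moreover have "Suc ?j mod n = (Suc i + Suc k) mod n" by (simp add: mod_Suc_eq)
    ultimately have "(vs ! ?j, vs ! ((Suc i + Suc k) mod n)) \<in> adjacency F"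
      by (simp add: adjacency_def)
    then show ?case using Suc by (meson Suc_lessD rtrancl.rtrancl_into_rtrancl)
  qed simp
  \<comment> \<open>From the far end of edge \<open>i\<close>, \<open>n - 1\<close> further steps
    lead back to its start.\<close>
  have "(Suc i + (n - 1)) mod n = i" using i n by simp
  then have "(vs ! (Suc i mod n), vs ! i) \<in> connected_in F" using path[of "n - 1"] n by simp
  then show False using iuw uw by (auto simp: doubleton_eq_iff dest: connected_in_sym)
qed

text \<open>
  \<open>P\<close> contains those components of \<open>F\<close> that may still have an outgoing edge in \<open>E\<close>.
\<close>

definition forest_state :: "'v set \<Rightarrow> 'v set set \<Rightarrow> 'v set set \<Rightarrow> 'v set set \<Rightarrow> bool" where
  "forest_state V E F P \<longleftrightarrow> F \<subseteq> E \<and> acyclic_edges F \<and>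
     (\<forall>C\<in>P. \<exists>u\<in>V. C = connected_in F `` {u}) \<and>
     (\<forall>x y. {x, y} \<in> E \<longrightarrow> (x, y) \<in> connected_in F \<or> x \<in> \<Union>P)"

lemma forest_state_class:
  assumes "forest_state V E F P" "C \<in> P" "x \<in> C"
  shows "C = connected_in F `` {x}"
proof -
  obtain u where "C = connected_in F `` {u}" using assms by (auto simp: forest_state_def)
  then show ?thesis using assms(3) connected_in_sym by (fastforce intro: rtrancl_trans)
qed

lemma forest_state_nonempty: "forest_state V E F P \<Longrightarrow> C \<in> P \<Longrightarrow> C \<noteq> {}"
  unfolding forest_state_def by fastforce

lemma forest_state_disjoint: "forest_state V E F P \<Longrightarrow> disjoint P"
  unfolding disjoint_def
proof (intro ballI impI)
  fix C D assume st: "forest_state V E F P" and CD: "C \<in> P" "D \<in> P" "C \<noteq> D"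
  have "C = D" if "x \<in> C" "x \<in> D" for x
    using forest_state_class[OF st CD(1) that(1)] forest_state_class[OF st CD(2) that(2)] by simp
  then show "C \<inter> D = {}" using CD(3) by auto
qed

lemma forest_state_subset:
  assumes G: "simple_graph V E" and st: "forest_state V E F P" and C: "C \<in> P"
  shows "C \<subseteq> V"
proof
  fix x assume "x \<in> C"
  obtain u where u: "u \<in> V" "C = connected_in F `` {u}"
    using st C by (auto simp: forest_state_def)
  then have "(u, x) \<in> connected_in F" using \<open>x \<in> C\<close> by auto
  then show "x \<in> V"
  proof (induction rule: rtrancl_induct)
    case (step y z)
    then have "{y, z} \<in> E" using st by (auto simp: adjacency_def forest_state_def)
    then show ?case using G by (auto simp: simple_graph_def)
  qed (use u in simp)
qed

lemma forest_state_finite: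
  assumes "simple_graph V E" "forest_state V E F P"
  shows "finite P"
proof -
  have "P \<subseteq> Pow V" using forest_state_subset[OF assms] by auto
  then show ?thesis using assms(1) by (auto simp: simple_graph_def intro: finite_subset)
qed

lemma sum_card_le:
  assumes G: "simple_graph V E" and st: "forest_state V E F P"
  shows "(\<Sum>C\<in>P. card C) \<le> card V"
proof -
  have V: "finite V" using G by (simp add: simple_graph_def)
  have sub: "C \<subseteq> V" if "C \<in> P" for C using forest_state_subset[OF G st that] .
  have "card (\<Union>P) = (\<Sum>C\<in>P. card C)"
  proof (rule card_Union_disjoint)
    show "pairwise disjnt P"
      using forest_state_disjoint[OF st] by (auto simp: disjoint_def pairwise_def disjnt_def)
    show "finite C" if "C \<in> P" for C using sub[OF that] V by (rule finite_subset)
  qed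
  moreover have "card (\<Union>P) \<le> card V" using sub V by (intro card_mono) auto
  ultimately show ?thesis by simp
qed

lemma card_classes_le:
  assumes G: "simple_graph V E" and st: "forest_state V E F P"
  shows "card P \<le> card V"
proof -
  have "1 \<le> card C" if "C \<in> P" for C
    using forest_state_nonempty[OF st that] forest_state_subset[OF G st that] G
    by (auto simp: simple_graph_def Suc_le_eq card_gt_0_iff intro: finite_subset)
  then have "(\<Sum>C\<in>P. 1) \<le> (\<Sum>C\<in>P. card C)" by (intro sum_mono) auto
  then show ?thesis using sum_card_le[OF G st] by simp
qed

lemma forest_state_init:
  assumes "simple_graph V E"
  shows "forest_state V E {} ((\<lambda>v. {v}) ` V)"
proof -
  have "adjacency ({} :: 'a set set) = {}" by (simp add: adjacency_def)
  moreover have "acyclic_edges {}" by (fastforce simp: acyclic_edges_def cycle_def)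
  moreover have "x \<in> V" if "{x, y} \<in> E" for x y
    using assms that by (auto simp: simple_graph_def)
  ultimately show ?thesis unfolding forest_state_def by fastforce
qed

lemma forest_state_final:
  assumes "forest_state V E F {}"
  shows "spanning_forest E F"
proof -
  have "adjacency F \<subseteq> adjacency E" "adjacency E \<subseteq> connected_in F"
    using assms by (auto simp: forest_state_def adjacency_def)
  then have "connected_in F = connected_in E" using rtrancl_subset by blast
  then show ?thesis using assms by (simp add: spanning_forest_def forest_state_def)
qed

text \<open>A class without outgoing edges is a finished component: edges at its vertices stay
  inside it, so the first alternative of the invariant covers them. Progress in a round is only
  guaranteed on the classes that do have outgoing edges.\<close>

lemma forest_state_remove:
  assumes G: "simple_graph V E" and st: "forest_state V E F P"
    and Q: "Q \<subseteq> P" "\<And>C. C \<in> P - Q \<Longrightarrow> edges_between E C (V - C) = 0"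
  shows "forest_state V E F Q"
  unfolding forest_state_def
proof (intro conjI allI impI)
  fix x y assume xy: "{x, y} \<in> E"
  then have "(x, y) \<in> connected_in F \<or> x \<in> \<Union>P" using st by (simp add: forest_state_def)
  moreover have "(x, y) \<in> connected_in F" if C: "C \<in> P - Q" "x \<in> C" for C
  proof -
    have "y \<in> V" using xy G by (auto simp: simple_graph_def)
    then have "y \<in> C" using Q(2)[OF C(1)] xy C(2) edges_between_pos_iff[OF G, of C "V - C"] by auto
    then show ?thesis using forest_state_class[OF st, of C x] C by auto
  qed
  ultimately show "(x, y) \<in> connected_in F \<or> x \<in> \<Union>Q" by auto
qed (use st Q in \<open>auto simp: forest_state_def\<close>)

text \<open>The invariant, applied to the edge read as \<open>{y, x}\<close>, places
  \<open>y\<close> in a listed class. Hence the merging partners of a class in \<open>P\<close> are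
  again in \<open>P\<close>.\<close>

lemma forest_state_neighbour:
  assumes st: "forest_state V E F P" and C: "C \<in> P" "x \<in> C" "y \<notin> C" and xy: "{x, y} \<in> E"
  shows "y \<in> \<Union>P"
proof -
  have "(y, x) \<notin> connected_in F"
    using forest_state_class[OF st C(1,2)] C(3) connected_in_sym by fastforce
  moreover have "{y, x} \<in> E" using xy by (simp add: insert_commute)
  ultimately show ?thesis using st unfolding forest_state_def by blast
qed

lemma forest_state_merge:
  assumes G: "simple_graph V E" and st: "forest_state V E F P" and CD: "C \<in> P" "D \<in> P" "C \<noteq> D"
    and uw: "u \<in> C" "w \<in> D" "{u, w} \<in> E"
  shows "forest_state V E (insert {u, w} F) (insert (C \<union> D) (P - {C, D}))"
proof -
  have C: "C = connected_in F `` {u}" and D: "D = connected_in F `` {w}"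
    using forest_state_class[OF st] CD uw by auto
  have "C \<inter> D = {}" using forest_state_disjoint[OF st] CD by (simp add: disjoint_def)
  then have nuw: "(u, w) \<notin> connected_in F" using C uw by auto
  have V: "u \<in> V" using uw(3) G by (auto simp: simple_graph_def)
  have new: "connected_in (insert {u, w} F) `` {u} = C \<union> D"
    using nuw connected_in_sym unfolding connected_in_insert C D by auto
  have old: "\<exists>v\<in>V. X = connected_in (insert {u, w} F) `` {v}" if X: "X \<in> P - {C, D}" for X
  proof -
    have "\<exists>v\<in>V. X = connected_in F `` {v}" using st X unfolding forest_state_def by blast
    then obtain v where v: "v \<in> V" "X = connected_in F `` {v}" by blast
    have "X \<inter> C = {}" "X \<inter> D = {}"
      using forest_state_disjoint[OF st] X CD by (auto simp: disjoint_def)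
    then have "(v, u) \<notin> connected_in F" "(v, w) \<notin> connected_in F"
      using v uw by auto
    then have "X = connected_in (insert {u, w} F) `` {v}"
      unfolding connected_in_insert v by auto
    then show ?thesis using v by blast
  qed
  have sub: "connected_in F \<subseteq> connected_in (insert {u, w} F)" by (auto simp: connected_in_insert)
  show ?thesis
    unfolding forest_state_def
  proof (intro conjI allI impI ballI)
    show "acyclic_edges (insert {u, w} F)"
      using st nuw by (auto simp: forest_state_def intro: acyclic_edges_insert)
    show "insert {u, w} F \<subseteq> E" using st uw by (auto simp: forest_state_def)
  next
    fix X assume "X \<in> insert (C \<union> D) (P - {C, D})"
    then show "\<exists>v\<in>V. X = connected_in (insert {u, w} F) `` {v}"
      using new V old by (metis insertE)
  next
    fix x y assume "{x, y} \<in> E"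
    then have "(x, y) \<in> connected_in F \<or> x \<in> \<Union>P" using st by (simp add: forest_state_def)
    then show "(x, y) \<in> connected_in (insert {u, w} F) \<or> x \<in> \<Union>(insert (C \<union> D) (P - {C, D}))"
      using sub by blast
  qed
qed

text \<open>Left classes are joined only to vertices on the right. So a left class still to be
  treated is intact in \<open>P'\<close>, and the class that holds \<open>w C\<close> is never a
  left class; no merge closes a cycle and each lowers the number of classes by one.
  \<open>F'\<close> and \<open>P'\<close> are chosen before \<open>E\<close>, as they must be known
  to the algorithm.\<close>

lemma merge_all:
  assumes "finite \<C>" "\<C> \<subseteq> \<L>" "\<L> \<subseteq> P" "finite P" "disjoint P"
    and "\<And>C. C \<in> \<C> \<Longrightarrow> u C \<in> C \<and> w C \<in> \<Union>(P - \<L>)"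
  shows "\<exists>F' P'. finite P' \<and> disjoint P' \<and> \<Union>P' = \<Union>P \<and> \<L> - \<C> \<subseteq> P' \<and>
    card P' + card \<C> = card P \<and>
    (\<forall>E. simple_graph V E \<longrightarrow> forest_state V E F P \<longrightarrow> (\<forall>C\<in>\<C>. {u C, w C} \<in> E) \<longrightarrow> forest_state V E F' P')"
  using assms(1,2,6)
proof (induction \<C> rule: finite_induct)
  case empty
  show ?case by (intro exI[of _ F] exI[of _ P]) (use assms(3-5) in auto)
next
  case (insert C \<C>)
  obtain F' P' where IH: "finite P'" "disjoint P'" "\<Union>P' = \<Union>P" "\<L> - \<C> \<subseteq> P'"
    "card P' + card \<C> = card P"
    "\<And>E. simple_graph V E \<Longrightarrow> forest_state V E F P \<Longrightarrow> (\<forall>C\<in>\<C>. {u C, w C} \<in> E) \<Longrightarrow> forest_state V E F' P'"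
    using insert.IH insert.prems by auto
  have uw: "u C \<in> C" "w C \<in> \<Union>(P - \<L>)" and CL: "C \<in> \<L>" "C \<notin> \<C>"
    using insert.prems insert.hyps by auto
  have C: "C \<in> P'" using IH(4) CL by auto
  obtain D where D: "D \<in> P'" "w C \<in> D" using uw(2) IH(3) by blast
  have notin: "w C \<notin> X" if "X \<in> \<L>" for X
  proof
    assume "w C \<in> X"
    moreover obtain Y where "Y \<in> P - \<L>" "w C \<in> Y" using uw(2) by blast
    moreover have "X \<in> P" "X \<noteq> Y" using that assms(3) calculation by auto
    ultimately show False using assms(5) by (auto simp: disjoint_def)
  qed
  have DC: "D \<noteq> C" "D \<notin> \<L>" using notin CL D by auto
  let ?P = "insert (C \<union> D) (P' - {C, D})"
  have new: "C \<union> D \<notin> P' - {C, D}"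
  proof
    assume "C \<union> D \<in> P' - {C, D}"
    then have "(C \<union> D) \<inter> C = {}" by (intro disjointD[OF IH(2)] C) auto
    then show False using uw by auto
  qed
  have "card ?P + card (insert C \<C>) = card P"
  proof -
    have "card (P' - {C, D}) = card P' - 2" using C D DC IH(1) by (simp add: card_Diff_subset)
    moreover have "2 \<le> card P'" using card_mono[of P' "{C, D}"] C D DC IH(1) by auto
    ultimately show ?thesis using new IH(1,5) insert.hyps by simp
  qed
  moreover have "disjoint ?P" using IH(2) C D unfolding disjoint_def by (auto simp: Int_Un_distrib Int_Un_distrib2)
  moreover have "\<Union>?P = \<Union>P" using IH(3) C D by blast
  moreover have "\<L> - insert C \<C> \<subseteq> ?P" using IH(4) DC by auto
  moreover have "forest_state V E (insert {u C, w C} F') ?P"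
    if "simple_graph V E" "forest_state V E F P" "\<forall>C\<in>insert C \<C>. {u C, w C} \<in> E" for E
    using that IH(6) C D DC uw by (intro forest_state_merge) auto
  moreover have "finite ?P" using IH(1) by simp
  ultimately show ?case by blast
qed

section \<open>Random samples\<close>

text \<open>A uniform number below \<open>2 ^ q\<close> is below \<open>2 ^ (q - i)\<close> with
  probability \<open>1 / 2 ^ i\<close>. One independent number per vertex thus provides the samples
  of all densities at once.\<close>

lemma prob_all_below:
  assumes "finite V" "X \<subseteq> V" "i \<le> q"
  shows "measure_pmf.prob (Pi_pmf V 0 (\<lambda>_. pmf_of_set {..<2 ^ q})) {g. \<forall>v\<in>X. g v < (2 :: nat) ^ (q - i)} =
    (1 / 2 ^ i) ^ card X"
proof -
  define B where "B v = (if v \<in> X then {..<(2 :: nat) ^ (q - i)} else UNIV)" for v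
  have "{g. \<forall>v\<in>X. g v < (2 :: nat) ^ (q - i)} = Pi V B"
    using assms(2) by (auto simp: B_def Pi_def)
  then have "measure_pmf.prob (Pi_pmf V 0 (\<lambda>_. pmf_of_set {..<2 ^ q})) {g. \<forall>v\<in>X. g v < (2 :: nat) ^ (q - i)} =
      (\<Prod>v\<in>V. measure_pmf.prob (pmf_of_set {..<2 ^ q}) (B v))"
    using assms(1) by (simp add: measure_Pi_pmf_Pi)
  also have "\<dots> = (\<Prod>v\<in>V. if v \<in> X then 1 / 2 ^ i else 1)"
  proof (rule prod.cong)
    fix v
    have "{..<(2::nat) ^ q} \<inter> {..<2 ^ (q - i)} = {..<2 ^ (q - i)}"
    proof -
      have "(2 :: nat) ^ (q - i) \<le> 2 ^ q" by (intro power_increasing) auto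
      then show ?thesis by (intro Int_absorb1) (simp only: lessThan_subset_iff)
    qed
    moreover have "{..<(2::nat) ^ q} \<noteq> {}" by (simp add: lessThan_empty_iff)
    moreover have "(2 :: real) ^ q = 2 ^ (q - i) * 2 ^ i"
      using assms(3) by (simp flip: power_add)
    ultimately show "measure_pmf.prob (pmf_of_set {..<2 ^ q}) (B v) = (if v \<in> X then 1 / 2 ^ i else 1)"
      by (simp add: B_def measure_pmf_of_set)
  qed simp
  also have "\<dots> = (1 / 2 ^ i) ^ card X"
    using assms by (subst prod.If_cases) (auto simp: Int_absorb1)
  finally show ?thesis .
qed

text \<open>
  The lower bound comes from \<open>2 c - c\<^sup>2 \<le> of_bool (c = 1)\<close>, whose left-hand side only
  involves first and second moments.
\<close>

lemma random_levels:
  fixes V :: "'v set"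
  assumes V: "finite V"
  shows "\<exists>H :: (nat \<Rightarrow> 'v set) pmf. finite (set_pmf H) \<and>
    (\<forall>N i. N \<subseteq> V \<longrightarrow> i \<le> q \<longrightarrow> 2 * card N \<le> 2 ^ i \<longrightarrow> 2 ^ i \<le> 4 * card N \<longrightarrow>
      1 / 8 \<le> measure_pmf.expectation H (\<lambda>h. of_bool (card (N \<inter> h i) = 1) :: real))"
proof -
  define G where "G = Pi_pmf V 0 (\<lambda>_. pmf_of_set {..<(2 :: nat) ^ q})"
  define h where "h g i = {v. g v < (2 :: nat) ^ (q - i)}" for g :: "'v \<Rightarrow> nat" and i
  have ne: "{..<(2 :: nat) ^ q} \<noteq> {}" by (simp add: lessThan_empty_iff)
  have finG: "finite (set_pmf G)"
    unfolding G_def set_Pi_pmf[OF V]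
    by (rule finite_PiE_dflt) (use V ne in auto)
  have "1 / 8 \<le> measure_pmf.expectation (map_pmf h G) (\<lambda>h. of_bool (card (N \<inter> h i) = 1) :: real)"
    if N: "N \<subseteq> V" and i: "i \<le> q" and d: "2 * card N \<le> 2 ^ i" "2 ^ i \<le> 4 * card N" for N i
  proof -
    define ind where "ind X g = indicat_real {g. \<forall>v\<in>X. g v < (2 :: nat) ^ (q - i)} g" for X :: "'v set" and g
    define p :: real where "p = 1 / 2 ^ i"
    have finN: "finite N" using N V by (rule finite_subset)
    have int: "integrable (measure_pmf G) f" for f :: "_ \<Rightarrow> real"
      by (rule integrable_measure_pmf_finite[OF finG])
    have E_ind: "measure_pmf.expectation G (ind X) = p ^ card X" if "X \<subseteq> V" for X
      using prob_all_below[OF V that i] by (simp add: ind_def[abs_def] G_def p_def)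
    have pw: "(\<Sum>v\<in>N. 2 * ind {v} g) - (\<Sum>v\<in>N. \<Sum>w\<in>N. ind {v, w} g) \<le> of_bool (card (N \<inter> h g i) = 1)" for g
    proof -
      define c where "c = card (N \<inter> h g i)"
      have c: "(\<Sum>v\<in>N. ind {v} g) = real c"
        using finN by (simp add: ind_def indicator_def h_def c_def sum.If_cases Int_def)
      have "ind {v, w} g = ind {v} g * ind {w} g" for v w
        by (simp add: ind_def indicator_def)
      then have "(\<Sum>v\<in>N. \<Sum>w\<in>N. ind {v, w} g) = real c * real c"
        by (simp add: sum_product [symmetric] c)
      then have "(\<Sum>v\<in>N. 2 * ind {v} g) - (\<Sum>v\<in>N. \<Sum>w\<in>N. ind {v, w} g) = (2 - real c) * real c"
        by (simp add: sum_distrib_left [symmetric] c algebra_simps)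
      also have "\<dots> \<le> of_bool (c = 1)"
      proof (cases "c \<le> 1")
        case True then show ?thesis by (auto simp: le_Suc_eq)
      next
        case False then show ?thesis by (simp add: mult_nonpos_nonneg)
      qed
      finally show ?thesis unfolding c_def .
    qed
    define d where "d = real (card N)"
    have dp: "1 / 4 \<le> d * p" "d * p \<le> 1 / 2" "0 \<le> p"
    proof -
      have "real (2 * card N) \<le> real (2 ^ i)" "real (2 ^ i) \<le> real (4 * card N)"
        using that(3,4) by (simp_all only: of_nat_le_iff)
      then show "1 / 4 \<le> d * p" "d * p \<le> 1 / 2" "0 \<le> p" by (simp_all add: d_def p_def field_simps)
    qed
    \<comment> \<open>The expected number \<open>d * p\<close> of sampled members of
      \<open>N\<close> lies between 1/4 and 1/2, so the two factors are at least 1/4 and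
      1/2.\<close>
    have "1 / 8 \<le> d * p * (1 - d * p)"
    proof -
      have "1 / 4 * (1 / 2) \<le> d * p * (1 - d * p)" using dp by (intro mult_mono) auto
      then show ?thesis by simp
    qed
    \<comment> \<open>The right-hand side is twice the first moment minus the second moment of the
      number of sampled members: among the ordered pairs, the \<open>d\<close> diagonal ones
      contribute \<open>p\<close> each and the \<open>d * d - d\<close> others the square of
      \<open>p\<close>.\<close>
    also have "\<dots> \<le> 2 * d * p - (d * p + (d * d - d) * p\<^sup>2)"
      using dp(3) by (simp add: algebra_simps power2_eq_square d_def)
    also have "\<dots> = (\<Sum>v\<in>N. 2 * p) - (\<Sum>v\<in>N. \<Sum>w\<in>N. p ^ card {v, w})"
    proof -
      have "(\<Sum>w\<in>N. p ^ card {v, w}) = p + (d - 1) * p\<^sup>2" if "v \<in> N" for v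
      proof -
        have "(\<Sum>w\<in>N. p ^ card {v, w}) = p ^ card {v, v} + (\<Sum>w\<in>N - {v}. p ^ card {v, w})"
          using finN that by (rule sum.remove)
        also have "(\<Sum>w\<in>N - {v}. p ^ card {v, w}) = (\<Sum>w\<in>N - {v}. p\<^sup>2)"
          by (intro sum.cong) (auto simp: power2_eq_square)
        also have "\<dots> = (d - 1) * p\<^sup>2"
        proof -
          have "1 \<le> card N" using finN that by (auto simp: Suc_le_eq card_gt_0_iff)
          then show ?thesis using that by (simp add: d_def of_nat_diff)
        qed
        finally show ?thesis by simp
      qed
      then have "(\<Sum>v\<in>N. \<Sum>w\<in>N. p ^ card {v, w}) = (\<Sum>v\<in>N. p + (d - 1) * p\<^sup>2)"
        by (rule sum.cong [OF refl])
      then show ?thesis by (simp add: d_def algebra_simps)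
    qed
    also have "\<dots> = measure_pmf.expectation G (\<lambda>g. (\<Sum>v\<in>N. 2 * ind {v} g) - (\<Sum>v\<in>N. \<Sum>w\<in>N. ind {v, w} g))"
    proof -
      have "(\<Sum>v\<in>N. \<Sum>w\<in>N. p ^ card {v, w}) = (\<Sum>v\<in>N. \<Sum>w\<in>N. measure_pmf.expectation G (ind {v, w}))"
        using N by (intro sum.cong refl E_ind [symmetric]) auto
      moreover have "(\<Sum>v\<in>N. 2 * p) = (\<Sum>v\<in>N. 2 * measure_pmf.expectation G (ind {v}))"
        using N by (intro sum.cong refl) (auto simp: E_ind)
      ultimately show ?thesis
        by (simp add: Bochner_Integration.integral_diff[OF int int] Bochner_Integration.integral_sum[OF int])
    qed
    also have "\<dots> \<le> measure_pmf.expectation G (\<lambda>g. of_bool (card (N \<inter> h g i) = 1) :: real)"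
      by (rule integral_mono[OF int int]) (rule pw)
    also have "\<dots> = measure_pmf.expectation (map_pmf h G) (\<lambda>h. of_bool (card (N \<inter> h i) = 1) :: real)"
      by simp
    finally show ?thesis .
  qed
  then show ?thesis using finG by (intro exI[of _ "map_pmf h G"]) auto
qed

text \<open>The memberships of \<open>C\<close> and of \<open>g C\<close>, a different element, in a
  random subset are independent fair coins, so \<open>C\<close> is counted with probability 1/4. In
  the application, \<open>g\<close> assigns to each class one adjacent class.\<close>

lemma expectation_random_split:
  assumes A: "finite A" and g: "\<And>C. C \<in> A \<Longrightarrow> g C \<in> A \<and> g C \<noteq> C"
  shows "measure_pmf.expectation (pmf_of_set (Pow A)) (\<lambda>\<L>. real (card {C \<in> \<L>. g C \<notin> \<L>})) =
    card A / 4"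
proof -
  have cnt: "4 * (\<Sum>\<L>\<in>Pow A. of_bool (C \<in> \<L> \<and> g C \<notin> \<L>)) = (2 ^ card A :: real)" if C: "C \<in> A" for C
  proof -
    define D where "D = g C"
    have D: "D \<in> A" "D \<noteq> C" using g[OF C] by (auto simp: D_def)
    have "bij_betw (insert C) (Pow (A - {C, D})) {\<L> \<in> Pow A. C \<in> \<L> \<and> D \<notin> \<L>}"
    proof (rule bij_betw_byWitness[where f' = "\<lambda>\<L>. \<L> - {C}"])
      show "insert C ` Pow (A - {C, D}) \<subseteq> {\<L> \<in> Pow A. C \<in> \<L> \<and> D \<notin> \<L>}"
        using C D by blast
      show "(\<lambda>\<L>. \<L> - {C}) ` {\<L> \<in> Pow A. C \<in> \<L> \<and> D \<notin> \<L>} \<subseteq> Pow (A - {C, D})"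
        by blast
      show "\<forall>\<L>\<in>Pow (A - {C, D}). insert C \<L> - {C} = \<L>" by blast
      show "\<forall>\<L>\<in>{\<L> \<in> Pow A. C \<in> \<L> \<and> D \<notin> \<L>}. insert C (\<L> - {C}) = \<L>" by blast
    qed
    then have "card {\<L> \<in> Pow A. C \<in> \<L> \<and> D \<notin> \<L>} = card (Pow (A - {C, D}))"
      by (rule bij_betw_same_card [symmetric])
    also have "\<dots> = 2 ^ (card A - 2)" using A C D by (simp add: card_Pow card_Diff_subset)
    finally have cnt: "card {\<L> \<in> Pow A. C \<in> \<L> \<and> D \<notin> \<L>} = 2 ^ (card A - 2)" .
    have "card {C, D} \<le> card A" using A C D by (intro card_mono) auto
    then have "2 \<le> card A" using D by simp
    then obtain m where "card A = 2 + m" using le_Suc_ex by blast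
    then have "4 * card {\<L> \<in> Pow A. C \<in> \<L> \<and> D \<notin> \<L>} = 2 ^ card A"
      unfolding cnt by simp
    then have "real (4 * card {\<L> \<in> Pow A. C \<in> \<L> \<and> D \<notin> \<L>}) = real (2 ^ card A)"
      by (rule arg_cong)
    then have "4 * real (card {\<L> \<in> Pow A. C \<in> \<L> \<and> D \<notin> \<L>}) = 2 ^ card A" by simp
    moreover have "(\<Sum>\<L>\<in>Pow A. of_bool (C \<in> \<L> \<and> D \<notin> \<L>) :: real) =
        real (card {\<L> \<in> Pow A. C \<in> \<L> \<and> D \<notin> \<L>})"
      using A by (simp add: of_bool_def sum.If_cases Int_def del: Pow_iff)
    ultimately show ?thesis unfolding D_def by simp
  qed
  have "(\<Sum>\<L>\<in>Pow A. real (card {C \<in> \<L>. g C \<notin> \<L>})) = (\<Sum>\<L>\<in>Pow A. \<Sum>C\<in>A. of_bool (C \<in> \<L> \<and> g C \<notin> \<L>))"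
  proof (rule sum.cong)
    fix \<L> assume "\<L> \<in> Pow A"
    then have "{C \<in> \<L>. g C \<notin> \<L>} = {C \<in> A. C \<in> \<L> \<and> g C \<notin> \<L>}" by auto
    then show "real (card {C \<in> \<L>. g C \<notin> \<L>}) = (\<Sum>C\<in>A. of_bool (C \<in> \<L> \<and> g C \<notin> \<L>))"
      using A by (simp add: sum.If_cases of_bool_def Int_def)
  qed simp
  also have "\<dots> = (\<Sum>C\<in>A. \<Sum>\<L>\<in>Pow A. of_bool (C \<in> \<L> \<and> g C \<notin> \<L>))" by (rule sum.swap)
  also have "\<dots> = (\<Sum>C\<in>A. 2 ^ card A / 4)"
    by (rule sum.cong) (use cnt in \<open>auto simp: field_simps\<close>)
  finally show ?thesis
    using A by (subst integral_pmf_of_set) (auto simp: card_Pow)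
qed

section \<open>Contraction rounds\<close>

lemma edges_between_sym_pos:
  "simple_graph V E \<Longrightarrow> 0 < edges_between E A B \<longleftrightarrow> 0 < edges_between E B A"
  unfolding edges_between_pos_iff by (metis insert_commute)

text \<open>A class costs 3 queries to test for outgoing edges and \<open>3 * b\<close> for each
  endpoint of one such edge; it is then dropped or merged, which lowers the number of classes by
  one. The factor \<open>b\<close> stays within a linear bound only once few classes are
  left.\<close>

lemma solvable_fallback:
  fixes V :: "'v set"
  assumes V: "finite V" "card V \<le> 2 ^ b"
  shows "solvable V {E. simple_graph V E \<and> forest_state V E F P} (\<lambda>_. (3 + 6 * real b) * real (card P))"
proof (induction "card P" arbitrary: F P)
  case 0
  have "spanning_forest E F" if E: "simple_graph V E" "forest_state V E F P" for E
  proof -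
    have "P = {}" using forest_state_finite[OF E] 0 by simp
    then show ?thesis using E(2) forest_state_final by simp
  qed
  then have "solvable V {E. simple_graph V E \<and> forest_state V E F P} (\<lambda>_. 0)"
    by (intro solvable_Output) auto
  then show ?case by (rule solvable_mono) auto
next
  case (Suc m)
  let ?\<E> = "{E. simple_graph V E \<and> forest_state V E F P}"
  show ?case
  proof (cases "?\<E> = {}")
    case True
    show ?thesis unfolding True by (rule solvable_empty)
  next
    case False
    then obtain E0 where E0: "simple_graph V E0" "forest_state V E0 F P" by auto
    have finP: "finite P" using forest_state_finite[OF E0] .
    obtain C where C: "C \<in> P" using Suc.hyps(2) by (metis card.empty ex_in_conv nat.distinct(1))
    have CV: "C \<subseteq> V" using forest_state_subset[OF E0 C] .
    have finC: "finite C" using CV V(1) by (rule finite_subset)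
    have card_le: "card X \<le> 2 ^ b" if "X \<subseteq> V" for X
      using card_mono[OF V(1) that] V(2) by simp
    let ?c = "\<lambda>_. (3 + 6 * real b) * real m"
    have "solvable V ?\<E> (\<lambda>E. 3 + (3 * real b + (3 * real b + ?c E)))"
    proof (rule solvable_edges_between[of _ _ C "V - C"])
      fix r
      let ?\<E>r = "{E \<in> ?\<E>. edges_between E C (V - C) = r}"
      show "solvable V ?\<E>r (\<lambda>E. 3 * real b + (3 * real b + ?c E))"
      proof (cases "r = 0")
        case True
        have m: "m = card (P - {C})" using Suc.hyps(2) C finP by simp
        show ?thesis
        proof (rule solvable_mono[OF Suc.hyps(1)[OF m]])
          fix E assume "E \<in> ?\<E>r"
          then show "E \<in> {E. simple_graph V E \<and> forest_state V E F (P - {C})}"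
            using True by (auto intro: forest_state_remove)
        qed (use m in simp)
      next
        case False
        show ?thesis
        proof (rule solvable_search[of C b])
          fix u assume u: "u \<in> C"
          let ?\<E>u = "{E \<in> ?\<E>r. 0 < edges_between E {u} (V - C)}"
          show "solvable V ?\<E>u (\<lambda>E. 3 * real b + ?c E)"
          proof (rule solvable_search[of "V - C" b _ _ "{u}"])
            fix w assume w: "w \<in> V - C"
            let ?\<E>w = "{E \<in> ?\<E>u. 0 < edges_between E {w} {u}}"
            have edge: "{u, w} \<in> E" if "E \<in> ?\<E>w" for E
              using that edges_between_pos_iff[of V E "{w}" "{u}"] by (auto simp: insert_commute)
            show "solvable V ?\<E>w ?c"
            proof (cases "w \<in> \<Union>P")
              case True
              then obtain D where D: "D \<in> P" "w \<in> D" by blast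
              then have "C \<noteq> D" using w by auto
              let ?P = "insert (C \<union> D) (P - {C, D})"
              have "C \<union> D \<notin> P - {C, D}"
              proof
                assume "C \<union> D \<in> P - {C, D}"
                then have "(C \<union> D) \<inter> C = {}"
                  by (intro disjointD[OF forest_state_disjoint[OF E0(2)]] C) auto
                then show False using u by auto
              qed
              moreover have "2 \<le> card P" using card_mono[of P "{C, D}"] finP C D \<open>C \<noteq> D\<close> by simp
              ultimately have m: "m = card ?P"
                using Suc.hyps(2) finP C D \<open>C \<noteq> D\<close> by (simp add: card_Diff_subset)
              show ?thesis
              proof (rule solvable_mono[OF Suc.hyps(1)[OF m]])
                fix E assume E: "E \<in> ?\<E>w"
                show "E \<in> {E. simple_graph V E \<and> forest_state V E (insert {u, w} F) ?P}"
                  using E edge[OF E] C D \<open>C \<noteq> D\<close> u by (auto intro!: forest_state_merge)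
              qed (use m in simp)
            next
              case False
              have "E \<notin> ?\<E>w" for E
              proof
                assume E: "E \<in> ?\<E>w"
                then have "forest_state V E F P" by simp
                from forest_state_neighbour[OF this C u _ edge[OF E]] False w show False by auto
              qed
              then have "?\<E>w = {}" by blast
              then show ?thesis by (simp only: solvable_empty)
            qed
          next
            fix E assume E: "E \<in> ?\<E>u"
            then show "0 < edges_between E (V - C) {u}" using edges_between_sym_pos[of V E] by auto
          qed (use V u CV card_le in auto)
        next
          fix E assume "E \<in> ?\<E>r" then show "0 < edges_between E C (V - C)" using False by auto
        qed (use finC CV card_le in auto)
      qed
    qed (use CV in auto)
    then show ?thesis
      by (rule solvable_mono) (use Suc.hyps(2) in \<open>auto simp: algebra_simps simp flip: Suc.hyps(2)\<close>)
  qed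
qed

section \<open>Numerical bounds for searching, sampling and identifying\<close>

lemma search_depth:
  assumes "1 \<le> (s :: nat)"
  shows "\<exists>\<kappa>. s \<le> 2 ^ \<kappa> \<and> real \<kappa> \<le> 2 * sqrt (real s)"
proof -
  define \<kappa> where "\<kappa> = (LEAST \<kappa>. s \<le> 2 ^ \<kappa>)"
  have le: "s \<le> 2 ^ \<kappa>" unfolding \<kappa>_def by (rule LeastI[of _ s]) simp
  \<comment> \<open>For \<open>\<kappa> = Suc j\<close>, minimality gives \<open>2 ^ j < s\<close>,
    so the square of \<open>\<kappa>\<close> is at most \<open>4 * s\<close>; this is the origin of
    the constant 2.\<close>
  have sq: "(Suc j)\<^sup>2 \<le> 4 * 2 ^ j" for j :: nat
  proof (induction j rule: less_induct)
    case (less j)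
    consider "j = 0" | "j = 1" | "j = 2" | i where "j = Suc i" "2 \<le> i"
      by (metis One_nat_def Suc_1 less_2_cases_iff not_less not0_implies_Suc not_less_eq_eq)
    then show ?case
    proof cases
      case 4
      have "(Suc i)\<^sup>2 \<le> 4 * 2 ^ i" using less 4 by simp
      moreover have "2 * 2 \<le> i * i" using 4 by (intro mult_le_mono) auto
      ultimately show ?thesis using 4 by (simp add: power2_eq_square algebra_simps)
    qed (auto simp: power2_eq_square)
  qed
  have "\<kappa>\<^sup>2 \<le> 4 * s"
  proof (cases \<kappa>)
    case (Suc j)
    then have "\<not> s \<le> 2 ^ j" using not_less_Least[of j "\<lambda>\<kappa>. s \<le> 2 ^ \<kappa>"] by (simp add: \<kappa>_def)
    then show ?thesis using sq[of j] Suc by simp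
  qed simp
  then have "real (\<kappa>\<^sup>2) \<le> real (4 * s)" by (simp only: of_nat_le_iff)
  then have "real \<kappa> \<le> sqrt (4 * real s)" by (intro real_le_rsqrt) simp
  then show ?thesis using le by (auto simp: real_sqrt_mult)
qed

lemma sum_sqrt_le:
  fixes f :: "'a \<Rightarrow> nat"
  shows "(\<Sum>i\<in>I. sqrt (real (f i))) \<le> sqrt (real (card I) * real (\<Sum>i\<in>I. f i))"
proof (rule real_le_rsqrt)
  have "(\<Sum>i\<in>I. 1 * sqrt (real (f i)))\<^sup>2 \<le> (\<Sum>i\<in>I. 1\<^sup>2) * (\<Sum>i\<in>I. (sqrt (real (f i)))\<^sup>2)"
    by (rule Cauchy_Schwarz_ineq_sum)
  then show "(\<Sum>i\<in>I. sqrt (real (f i)))\<^sup>2 \<le> real (card I) * real (\<Sum>i\<in>I. f i)" by simp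
qed

text \<open>This is the window in which \<open>random_levels\<close> applies: at density
  \<open>1 / 2 ^ s\<close>, between 1/4 and 1/2 of a neighbour is sampled on average. The scales end
  at \<open>b + 1\<close> because \<open>2 * d \<le> 2 ^ (b + 1)\<close>.\<close>

lemma sampling_scale:
  assumes "1 \<le> (d :: nat)" "d \<le> 2 ^ b"
  shows "\<exists>s \<le> b + 1. 2 * d \<le> 2 ^ s \<and> 2 ^ s \<le> 4 * d"
proof -
  define s where "s = (LEAST s. 2 * d \<le> 2 ^ s)"
  have b: "2 * d \<le> 2 ^ (b + 1)" using assms by simp
  have "2 * d \<le> 2 ^ s" unfolding s_def by (rule LeastI[of _ "b + 1"]) (rule b)
  moreover have "s \<le> b + 1" unfolding s_def by (rule Least_le) (rule b)
  moreover have "2 ^ s \<le> 4 * d"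
  proof (cases s)
    case (Suc j)
    then have "\<not> 2 * d \<le> 2 ^ j" using not_less_Least[of j "\<lambda>s. 2 * d \<le> 2 ^ s"] by (simp add: s_def)
    then show ?thesis using Suc by simp
  qed (use assms in simp)
  ultimately show ?thesis by blast
qed

text \<open>A full block takes \<open>M = 3 * b * 2 ^ (k + 1)\<close> queries for \<open>K\<close>
  coins, and \<open>M / K = 12 * b / (k + 2) \<le> 24\<close> because
  \<open>b \<le> 2 * k + 1\<close>. Rounding up adds at most one \<open>M\<close> for each of the
  \<open>q\<close> scales.\<close>

lemma identify_cost:
  fixes \<sigma> :: "'v \<Rightarrow> nat"
  assumes "finite S" "card S \<le> m" "b \<le> 2 * k + 1"
  shows "(\<Sum>i<q. real (3 * b * ((card {u \<in> S. \<sigma> u = i} div coins k + 1) * 2 ^ (k + 1)))) \<le>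
    24 * real m + 3 * real b * real q * 2 ^ (k + 1)"
proof -
  define K where "K = real (coins k)"
  have "2 * K = real (2 * coins k)" by (simp add: K_def)
  also have "\<dots> = (real k + 2) * 2 ^ k" unfolding coins_eq by (simp add: algebra_simps)
  finally have K: "2 * K = (real k + 2) * 2 ^ k" .
  have K0: "0 < K" using coins_pos by (simp add: K_def)
  define M where "M = 3 * real b * 2 ^ (k + 1)"
  have M: "M \<le> 24 * K"
  proof -
    have "real b \<le> 2 * (real k + 2)" using of_nat_mono[OF assms(3), where 'a = real] by simp
    then have "6 * real b * 2 ^ k \<le> 6 * (2 * (real k + 2)) * 2 ^ k"
      by (intro mult_right_mono mult_left_mono) auto
    then show ?thesis using K by (simp add: M_def algebra_simps)
  qed
  have "real (3 * b * ((x div coins k + 1) * 2 ^ (k + 1))) \<le> M / K * real x + M" for x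
  proof -
    have "real (x div coins k) \<le> real x / K" unfolding K_def by (rule of_nat_div_le_of_nat)
    then have "M * real (x div coins k) \<le> M * (real x / K)"
      by (intro mult_left_mono) (auto simp: M_def)
    then show ?thesis by (simp add: M_def algebra_simps)
  qed
  then have "(\<Sum>i<q. real (3 * b * ((card {u \<in> S. \<sigma> u = i} div coins k + 1) * 2 ^ (k + 1)))) \<le>
      (\<Sum>i<q. M / K * real (card {u \<in> S. \<sigma> u = i}) + M)"
    by (intro sum_mono)
  also have "\<dots> = M / K * real (\<Sum>i<q. card {u \<in> S. \<sigma> u = i}) + real q * M"
    by (simp add: sum.distrib sum_distrib_left)
  also have "(\<Sum>i<q. card {u \<in> S. \<sigma> u = i}) = card (\<Union>i<q. {u \<in> S. \<sigma> u = i})"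
    using assms(1) by (intro card_UN_disjoint [symmetric]) auto
  also have "M / K * real (card (\<Union>i<q. {u \<in> S. \<sigma> u = i})) \<le> 24 * real m"
  proof (rule mult_mono)
    show "M / K \<le> 24" using M K0 by (simp add: divide_simps)
    have "card (\<Union>i<q. {u \<in> S. \<sigma> u = i}) \<le> card S" using assms(1) by (intro card_mono) auto
    then show "real (card (\<Union>i<q. {u \<in> S. \<sigma> u = i})) \<le> real m" using assms(2) by simp
  qed auto
  finally show ?thesis by (simp add: M_def algebra_simps)
qed

section \<open>One contraction round and the recursion over rounds\<close>

text \<open>Vertex names have \<open>b\<close> bits. \<open>b_le\<close> makes blocks large enough
  to save a factor of order \<open>b\<close>; since the overhead grows with \<open>2 ^ k\<close>,
  the final choice is the least such \<open>k\<close>.\<close>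

locale query_parameters =
  fixes V :: "'v set" and b k :: nat
  assumes finite_V: "finite V" and card_V: "card V \<le> 2 ^ b" and b_le: "b \<le> 2 * k + 1"
begin

text \<open>The additive term of \<open>identify_cost\<close> for the \<open>b + 2\<close> scales
  from 0 to \<open>b + 1\<close>.\<close>

definition round_overhead :: real where
  "round_overhead = 3 * real b * real (b + 2) * 2 ^ (k + 1)"

text \<open>The 30 queries per endpoint are 3 for its degree into the right side, 3 to test whether
  its sample contains exactly one neighbour, and 24 for identification. As \<open>next_round\<close>
  is affine in the number of classes, only the expected number of merges enters, and this is at
  least \<open>card \<C> / 8\<close>.\<close>

lemma solvable_contract:
  assumes \<alpha>: "0 \<le> \<beta>"
    and next_round: "\<And>F' P'. solvable V {E. simple_graph V E \<and> forest_state V E F' P'}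
      (\<lambda>_. \<alpha> + \<beta> * real (card P'))"
    and A: "finite A" "disjoint A" "\<C> \<subseteq> \<L>" "\<L> \<subseteq> A" "\<Union>A \<subseteq> V"
    and u: "\<forall>C\<in>\<C>. u C \<in> C"
  shows "solvable V {E. simple_graph V E \<and> forest_state V E F A \<and>
      (\<forall>C\<in>\<C>. 0 < edges_between E {u C} (\<Union>(A - \<L>)))}
    (\<lambda>_. 30 * real (card \<C>) + round_overhead + \<alpha> + \<beta> * (real (card A) - real (card \<C>) / 8))"
proof -
  define R where "R = \<Union>(A - \<L>)"
  define U where "U = u ` \<C>"
  define m where "m = card \<C>"
  let ?\<E> = "{E. simple_graph V E \<and> forest_state V E F A \<and> (\<forall>C\<in>\<C>. 0 < edges_between E {u C} R)}"
  have fin\<C>: "finite \<C>" using A by (meson finite_subset)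
  have inj: "inj_on u \<C>"
  proof (rule inj_onI)
    fix C D assume CD: "C \<in> \<C>" "D \<in> \<C>" "u C = u D"
    show "C = D"
    proof (rule ccontr)
      assume "C \<noteq> D"
      then have "C \<inter> D = {}" using CD A by (intro disjointD[OF A(2)]) auto
      then show False using CD u by auto
    qed
  qed
  have cardU: "card U = m" unfolding U_def m_def by (rule card_image[OF inj])
  have finU: "finite U" using fin\<C> by (simp add: U_def)
  have RV: "R \<subseteq> V" using A by (auto simp: R_def)
  have U\<L>: "U \<subseteq> \<Union>\<L>" using A u by (auto simp: U_def)
  also have "\<dots> \<subseteq> \<Union>A" using A(4) by (rule Union_mono)
  finally have UV: "U \<subseteq> V" using A(5) by (rule order_trans)
  have "\<Union>\<L> \<inter> R = {}"
  proof -
    have "C \<inter> D = {}" if "C \<in> \<L>" "D \<in> A - \<L>" for C D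
      using that A(4) by (intro disjointD[OF A(2)]) auto
    then show ?thesis unfolding R_def by blast
  qed
  then have UR: "U \<inter> R = {}" using U\<L> by blast
  let ?c = "30 * real m + round_overhead + \<alpha> + \<beta> * (real (card A) - real m / 8)"
  let ?c' = "27 * real m + round_overhead + \<alpha> + \<beta> * (real (card A) - real m / 8)"
  have "solvable V ?\<E> (\<lambda>E. 3 * real (card U) + ?c')"
  proof (rule solvable_batch[OF finU, where X = "\<lambda>v. {v}" and Y = "\<lambda>_. R"])
    fix d
    let ?\<E>d = "{E \<in> ?\<E>. \<forall>v\<in>U. edges_between E {v} R = d v}"
    show "solvable V ?\<E>d (\<lambda>_. ?c')"
    proof (cases "?\<E>d = {}")
      case True
      show ?thesis unfolding True by (rule solvable_empty)
    next
      case False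
      then obtain E0 where E0: "E0 \<in> ?\<E>d" by blast
      have d_eq: "card {w \<in> R. {v, w} \<in> E} = d v" if "E \<in> ?\<E>d" "v \<in> U" for E v
        using that edges_between_singleton[of E v R] by auto
      have "\<exists>s \<le> b + 1. 2 * d v \<le> 2 ^ s \<and> 2 ^ s \<le> 4 * d v" if "v \<in> U" for v
      proof (rule sampling_scale)
        show "1 \<le> d v" using E0 that by (auto simp: U_def Suc_le_eq)
        have "d v \<le> card V"
          unfolding d_eq[OF E0 that, symmetric] using RV by (intro card_mono finite_V) auto
        then show "d v \<le> 2 ^ b" using card_V by simp
      qed
      then obtain \<sigma> where \<sigma>: "\<And>v. v \<in> U \<Longrightarrow> \<sigma> v \<le> b + 1 \<and> 2 * d v \<le> 2 ^ \<sigma> v \<and> 2 ^ \<sigma> v \<le> 4 * d v"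
        by metis
      obtain H :: "(nat \<Rightarrow> 'v set) pmf" where H: "finite (set_pmf H)"
        "\<And>N i. N \<subseteq> V \<Longrightarrow> i \<le> b + 1 \<Longrightarrow> 2 * card N \<le> 2 ^ i \<Longrightarrow> 2 ^ i \<le> 4 * card N \<Longrightarrow>
          1 / 8 \<le> measure_pmf.expectation H (\<lambda>h. of_bool (card (N \<inter> h i) = 1) :: real)"
        using random_levels[OF finite_V, of "b + 1"] by blast
      define S where "S E h = {v \<in> U. edges_between E {v} (R \<inter> h (\<sigma> v)) = 1}" for E h
      define c where "c h E = 27 * real m + round_overhead + \<alpha> + \<beta> * (real (card A) - real (card (S E h)))"
        for h E
      have "solvable V ?\<E>d (\<lambda>E. measure_pmf.expectation H (\<lambda>h. c h E))"
      proof (rule solvable_Sample[OF H(1)])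
        fix h
        have "solvable V ?\<E>d (\<lambda>E. 3 * real (card U) +
          (24 * real m + round_overhead + \<alpha> + \<beta> * (real (card A) - real (card (S E h)))))"
        proof (rule solvable_batch[OF finU, where X = "\<lambda>v. {v}" and Y = "\<lambda>v. R \<inter> h (\<sigma> v)"])
          fix r
          let ?\<E>r = "{E \<in> ?\<E>d. \<forall>v\<in>U. edges_between E {v} (R \<inter> h (\<sigma> v)) = r v}"
          \<comment> \<open>The set \<open>S E h\<close> depends on the unknown graph, but the
            answers \<open>r\<close> reveal it: it is the same \<open>T\<close> for all consistent
            graphs.\<close>
          define T where "T = {v \<in> U. r v = 1}"
          have T: "S E h = T" if "E \<in> ?\<E>r" for E using that by (auto simp: S_def T_def)
          have TU: "T \<subseteq> U" by (auto simp: T_def)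
          let ?c2 = "\<lambda>_. \<alpha> + \<beta> * (real (card A) - real (card T))"
          let ?id = "(\<Sum>i<b + 2. real (3 * b * ((card {v \<in> T. \<sigma> v = i} div coins k + 1) * 2 ^ (k + 1))))"
          have "solvable V ?\<E>r (\<lambda>E. ?id + ?c2 E)"
          proof (rule solvable_identify_scales[OF finite_V card_V, where R = "\<lambda>i. R \<inter> h i" and T = R])
            fix \<phi> assume \<phi>: "\<forall>v\<in>T. \<phi> v \<in> R"
            define \<D> where "\<D> = {C \<in> \<C>. u C \<in> T}"
            have "u ` \<D> = T" using TU by (auto simp: \<D>_def U_def)
            moreover have "inj_on u \<D>" by (rule inj_on_subset[OF inj]) (auto simp: \<D>_def)
            ultimately have card\<D>: "card \<D> = card T" using card_image[of u \<D>] by simp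
            have "\<exists>F' P'. finite P' \<and> disjoint P' \<and> \<Union>P' = \<Union>A \<and> \<L> - \<D> \<subseteq> P' \<and>
                card P' + card \<D> = card A \<and>
                (\<forall>E. simple_graph V E \<longrightarrow> forest_state V E F A \<longrightarrow> (\<forall>C\<in>\<D>. {u C, \<phi> (u C)} \<in> E) \<longrightarrow>
                  forest_state V E F' P')"
            proof (rule merge_all)
              show "finite \<D>" using fin\<C> by (simp add: \<D>_def)
              show "\<D> \<subseteq> \<L>" using A(3) by (auto simp: \<D>_def)
              show "u C \<in> C \<and> \<phi> (u C) \<in> \<Union>(A - \<L>)" if "C \<in> \<D>" for C
                using that u \<phi> unfolding \<D>_def R_def by simp
            qed (use A in simp_all)
            then obtain F' P' where P': "card P' + card T = card A"
              "\<forall>E. simple_graph V E \<longrightarrow> forest_state V E F A \<longrightarrow> (\<forall>C\<in>\<D>. {u C, \<phi> (u C)} \<in> E) \<longrightarrow>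
                forest_state V E F' P'"
              unfolding card\<D> by (elim exE conjE)
            show "solvable V {E \<in> ?\<E>r. \<forall>v\<in>T. {v, \<phi> v} \<in> E} ?c2"
            proof (rule solvable_mono[OF next_round[of F' P']])
              fix E assume E: "E \<in> {E \<in> ?\<E>r. \<forall>v\<in>T. {v, \<phi> v} \<in> E}"
              then show "E \<in> {E. simple_graph V E \<and> forest_state V E F' P'}"
                using P'(2)[rule_format, of E] by (simp add: \<D>_def)
            next
              show "\<alpha> + \<beta> * real (card P') \<le> \<alpha> + \<beta> * (real (card A) - real (card T))"
                unfolding P'(1)[symmetric] by simp
            qed
          next
            fix E v assume "E \<in> ?\<E>r" "v \<in> T"
            then show "edges_between E {v} (R \<inter> h (\<sigma> v)) = 1" by (simp add: T_def)
          next
            fix v assume "v \<in> T"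
            then show "\<sigma> v < b + 2" using \<sigma>[of v] TU by auto
          qed (use TU UV UR RV in auto)
          then show "solvable V ?\<E>r (\<lambda>E. 24 * real m + round_overhead + \<alpha> +
              \<beta> * (real (card A) - real (card (S E h))))"
          proof (rule solvable_mono)
            fix E assume E: "E \<in> ?\<E>r"
            have "card T \<le> m" using card_mono[OF finU TU] cardU by simp
            then have "?id \<le> 24 * real m + round_overhead"
              unfolding round_overhead_def using finite_subset[OF TU finU] b_le by (intro identify_cost)
            then show "?id + ?c2 E \<le> 24 * real m + round_overhead + \<alpha> +
              \<beta> * (real (card A) - real (card (S E h)))"
              using T[OF E] by simp
          qed simp
        qed (use UV RV UR in auto)
        then show "solvable V ?\<E>d (c h)"
          by (rule solvable_mono) (simp_all add: c_def cardU)
      qed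
      then show ?thesis
      proof (rule solvable_mono)
        fix E assume E: "E \<in> ?\<E>d"
        have int: "integrable (measure_pmf H) f" for f :: "_ \<Rightarrow> real"
          by (rule integrable_measure_pmf_finite[OF H(1)])
        \<comment> \<open>Linearity of expectation: all endpoints share one random \<open>h\<close>,
          and each succeeds with probability at least 1/8.\<close>
        have "real m / 8 = (\<Sum>v\<in>U. 1 / 8)" by (simp add: cardU)
        also have "\<dots> \<le> (\<Sum>v\<in>U. measure_pmf.expectation H
            (\<lambda>h. of_bool (edges_between E {v} (R \<inter> h (\<sigma> v)) = 1)))"
        proof (rule sum_mono)
          fix v assume v: "v \<in> U"
          let ?N = "{w \<in> R. {v, w} \<in> E}"
          have "edges_between E {v} (R \<inter> h (\<sigma> v)) = card (?N \<inter> h (\<sigma> v))" for h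
            unfolding edges_between_singleton by (rule arg_cong[of _ _ card]) auto
          moreover have "1 / 8 \<le> measure_pmf.expectation H (\<lambda>h. of_bool (card (?N \<inter> h (\<sigma> v)) = 1) :: real)"
            by (rule H(2)) (use \<sigma>[OF v] RV in \<open>auto simp: d_eq[OF E v]\<close>)
          ultimately show "1 / 8 \<le> measure_pmf.expectation H
              (\<lambda>h. of_bool (edges_between E {v} (R \<inter> h (\<sigma> v)) = 1) :: real)" by simp
        qed
        also have "\<dots> = measure_pmf.expectation H (\<lambda>h. \<Sum>v\<in>U. of_bool (edges_between E {v} (R \<inter> h (\<sigma> v)) = 1))"
          by (rule Bochner_Integration.integral_sum [OF int, symmetric])
        also have "(\<lambda>h. \<Sum>v\<in>U. of_bool (edges_between E {v} (R \<inter> h (\<sigma> v)) = 1)) = (\<lambda>h. real (card (S E h)))"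
          using finU by (simp add: S_def of_bool_def sum.If_cases Int_def)
        finally have "\<beta> * (real m / 8) \<le> \<beta> * measure_pmf.expectation H (\<lambda>h. real (card (S E h)))"
          using \<alpha> by (rule mult_left_mono)
        moreover have "measure_pmf.expectation H (\<lambda>h. c h E) = 27 * real m + round_overhead + \<alpha> +
          \<beta> * (real (card A) - measure_pmf.expectation H (\<lambda>h. real (card (S E h))))"
          unfolding c_def by (simp add: Bochner_Integration.integral_diff[OF int int]
            Bochner_Integration.integral_add[OF int int])
        ultimately show "measure_pmf.expectation H (\<lambda>h. c h E) \<le> ?c'"
          by (simp add: algebra_simps)
      qed simp
    qed
  qed (use UV RV UR in auto)
  then show ?thesis
    unfolding R_def [symmetric] m_def [symmetric]
    by (rule solvable_mono) (auto simp: cardU)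
qed

text \<open>In expectation at least 1/4 of the classes are left with an edge to the right, and at
  least 1/8 of these get merged; this gives the factor 31/32. The 33 is 3 for testing a left class
  plus the 30 of \<open>solvable_contract\<close>; the 6 is 3 queries per search step times the 2 of
  \<open>search_depth\<close>.\<close>

lemma solvable_active_round:
  assumes \<alpha>: "0 \<le> \<beta>"
    and next_round: "\<And>F' P'. solvable V {E. simple_graph V E \<and> forest_state V E F' P'}
      (\<lambda>_. \<alpha> + \<beta> * real (card P'))"
  shows "solvable V {E. simple_graph V E \<and> forest_state V E F A \<and>
      (\<forall>C\<in>A. 0 < edges_between E C (V - C))}
    (\<lambda>_. 33 * real (card A) + 6 * sqrt (real (card A) * real (card V)) + round_overhead +
      \<alpha> + \<beta> * (31 / 32 * real (card A)))"
proof (cases "{E. simple_graph V E \<and> forest_state V E F A \<and>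
      (\<forall>C\<in>A. 0 < edges_between E C (V - C))} = {}")
  case True
  show ?thesis unfolding True by (rule solvable_empty)
next
  case False
  let ?\<E> = "{E. simple_graph V E \<and> forest_state V E F A \<and> (\<forall>C\<in>A. 0 < edges_between E C (V - C))}"
  obtain E0 where E0: "simple_graph V E0" "forest_state V E0 F A" using False by auto
  note finA = forest_state_finite[OF E0] and disjA = forest_state_disjoint[OF E0(2)]
    and subA = forest_state_subset[OF E0]
  define a where "a = real (card A)"
  have "\<exists>\<kappa>. card C \<le> 2 ^ \<kappa> \<and> real \<kappa> \<le> 2 * sqrt (real (card C))" if "C \<in> A" for C
  proof (rule search_depth)
    show "1 \<le> card C"
      using forest_state_nonempty[OF E0(2) that] finite_subset[OF subA[OF that] finite_V]
      by (simp add: Suc_le_eq card_gt_0_iff)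
  qed
  then obtain \<kappa> where \<kappa>: "\<And>C. C \<in> A \<Longrightarrow> card C \<le> 2 ^ \<kappa> C \<and> real (\<kappa> C) \<le> 2 * sqrt (real (card C))"
    by metis
  define M where "M E \<L> = card {C \<in> \<L>. 0 < edges_between E C (\<Union>(A - \<L>))}" for E \<L>
  define Z where "Z = 6 * sqrt (a * real (card V))"
  define c where "c \<L> E = 33 * a + Z + round_overhead + \<alpha> + \<beta> * (a - real (M E \<L>) / 8)" for \<L> E
  have search_cost: "3 * (\<Sum>C\<in>\<C>. real (\<kappa> C)) \<le> Z" if \<C>: "\<C> \<subseteq> A" for \<C>
  proof -
    have "(\<Sum>C\<in>\<C>. real (\<kappa> C)) \<le> (\<Sum>C\<in>A. real (\<kappa> C))"
      using finA \<C> by (intro sum_mono2) auto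
    also have "\<dots> \<le> (\<Sum>C\<in>A. 2 * sqrt (real (card C)))" by (intro sum_mono) (use \<kappa> in auto)
    also have "\<dots> = 2 * (\<Sum>C\<in>A. sqrt (real (card C)))" by (simp add: sum_distrib_left)
    also have "\<dots> \<le> 2 * sqrt (a * real (\<Sum>C\<in>A. card C))"
      unfolding a_def by (intro mult_left_mono sum_sqrt_le) simp
    also have "\<dots> \<le> 2 * sqrt (a * real (card V))"
    proof -
      have "real (\<Sum>C\<in>A. card C) \<le> real (card V)"
        using sum_card_le[OF E0] by (simp only: of_nat_le_iff)
      then show ?thesis by (intro mult_left_mono real_sqrt_le_mono) (auto simp: a_def)
    qed
    finally show ?thesis by (simp add: Z_def)
  qed
  have finPow: "finite (Pow A)" "Pow A \<noteq> {}" using finA by auto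
  have "solvable V ?\<E> (\<lambda>E. measure_pmf.expectation (pmf_of_set (Pow A)) (\<lambda>\<L>. c \<L> E))"
  proof (rule solvable_Sample)
    show "finite (set_pmf (pmf_of_set (Pow A)))" using finPow by simp
  next
    fix \<L> assume "\<L> \<in> set_pmf (pmf_of_set (Pow A))"
    then have \<L>: "\<L> \<subseteq> A" using finPow by simp
    have fin\<L>: "finite \<L>" using \<L> finA by (rule finite_subset)
    let ?R = "\<Union>(A - \<L>)"
    have UA: "\<Union>A \<subseteq> V" using subA by (rule Union_least)
    then have R: "?R \<subseteq> V" by blast
    have CR: "C \<inter> ?R = {}" if "C \<in> \<L>" for C
    proof -
      have "C \<inter> D = {}" if "D \<in> A - \<L>" for D
        using that \<open>C \<in> \<L>\<close> \<L> by (intro disjointD[OF disjA]) auto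
      then show ?thesis by blast
    qed
    have "solvable V ?\<E> (\<lambda>E. 3 * real (card \<L>) +
      (Z + (30 * a + round_overhead + \<alpha> + \<beta> * (a - real (M E \<L>) / 8))))"
    proof (rule solvable_batch[OF fin\<L>, where X = "\<lambda>C. C" and Y = "\<lambda>_. ?R"])
      fix r
      let ?\<E>r = "{E \<in> ?\<E>. \<forall>C\<in>\<L>. edges_between E C ?R = r C}"
      define \<C> where "\<C> = {C \<in> \<L>. 0 < r C}"
      have M: "M E \<L> = card \<C>" if "E \<in> ?\<E>r" for E
        using that unfolding M_def \<C>_def by (intro arg_cong[of _ _ card]) auto
      have \<C>: "\<C> \<subseteq> \<L>" by (auto simp: \<C>_def)
      let ?c = "\<lambda>_. 30 * real (card \<C>) + round_overhead + \<alpha> + \<beta> * (a - real (card \<C>) / 8)"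
      have "solvable V ?\<E>r (\<lambda>E. 3 * (\<Sum>C\<in>\<C>. real (\<kappa> C)) + ?c E)"
      proof (rule solvable_search_all[where T = ?R])
        fix u assume u: "\<forall>C\<in>\<C>. u C \<in> C"
        show "solvable V {E \<in> ?\<E>r. \<forall>C\<in>\<C>. 0 < edges_between E {u C} ?R} ?c"
          unfolding a_def
        proof (rule solvable_mono[OF solvable_contract[OF \<alpha> next_round finA disjA \<C> \<L> UA u, of F]])
          fix E assume E: "E \<in> {E \<in> ?\<E>r. \<forall>C\<in>\<C>. 0 < edges_between E {u C} ?R}"
          then show "E \<in> {E. simple_graph V E \<and> forest_state V E F A \<and>
              (\<forall>C\<in>\<C>. 0 < edges_between E {u C} ?R)}" by simp
        qed simp
      next
        fix E assume "E \<in> ?\<E>r"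
        then show "simple_graph V E" by simp
      next
        show "finite \<C>" using \<C> fin\<L> by (rule finite_subset)
      next
        fix C assume "C \<in> \<C>"
        then show "C \<subseteq> V \<and> C \<inter> ?R = {} \<and> card C \<le> 2 ^ \<kappa> C"
          using subA[of C] CR[of C] \<kappa>[of C] \<C> \<L> by blast
      next
        fix E C assume "E \<in> ?\<E>r" "C \<in> \<C>"
        then show "0 < edges_between E C ?R" by (auto simp: \<C>_def)
      qed (use R finite_V in simp_all)
      then show "solvable V ?\<E>r (\<lambda>E. Z + (30 * a + round_overhead + \<alpha> + \<beta> * (a - real (M E \<L>) / 8)))"
      proof (rule solvable_mono)
        fix E assume E: "E \<in> ?\<E>r"
        have "card \<C> \<le> card A" using \<C> \<L> finA by (intro card_mono) auto
        moreover have "3 * (\<Sum>C\<in>\<C>. real (\<kappa> C)) \<le> Z" using \<C> \<L> by (intro search_cost) auto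
        ultimately show "3 * (\<Sum>C\<in>\<C>. real (\<kappa> C)) + ?c E \<le>
          Z + (30 * a + round_overhead + \<alpha> + \<beta> * (a - real (M E \<L>) / 8))"
          unfolding M[OF E] a_def by simp
      qed simp
    next
      fix C assume "C \<in> \<L>"
      then show "C \<subseteq> V \<and> ?R \<subseteq> V \<and> C \<inter> ?R = {}" using subA[of C] \<L> R CR[of C] by auto
    next
      fix E assume "E \<in> ?\<E>"
      then show "simple_graph V E" by simp
    qed
    then show "solvable V ?\<E> (c \<L>)"
    proof (rule solvable_mono)
      fix E
      have "card \<L> \<le> card A" using \<L> finA by (intro card_mono)
      then show "3 * real (card \<L>) + (Z + (30 * a + round_overhead + \<alpha> + \<beta> * (a - real (M E \<L>) / 8))) \<le> c \<L> E"
        by (simp add: c_def a_def)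
    qed simp
  qed
  then show ?thesis
  proof (rule solvable_mono)
    fix E assume E: "E \<in> ?\<E>"
    then have G: "simple_graph V E" "forest_state V E F A" by auto
    \<comment> \<open>The partner map \<open>g\<close> depends on the unknown graph; it occurs only
      in the analysis and not in the algorithm.\<close>
    have "\<exists>D. D \<in> A \<and> D \<noteq> C \<and> 0 < edges_between E C D" if C: "C \<in> A" for C
    proof -
      obtain x y where xy: "x \<in> C" "y \<in> V - C" "{x, y} \<in> E"
        using E C edges_between_pos_iff[OF G(1), of C "V - C"] by auto
      then obtain D where "D \<in> A" "y \<in> D" using forest_state_neighbour[OF G(2) C, of x y] by auto
      then show ?thesis using xy edges_between_pos_iff[OF G(1)] by blast
    qed
    then obtain g where g: "\<And>C. C \<in> A \<Longrightarrow> g C \<in> A \<and> g C \<noteq> C \<and> 0 < edges_between E C (g C)"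
      by metis
    have int: "integrable (measure_pmf (pmf_of_set (Pow A))) f" for f :: "_ \<Rightarrow> real"
      by (rule integrable_measure_pmf_finite) (use finPow in simp)
    have "a / 4 = measure_pmf.expectation (pmf_of_set (Pow A)) (\<lambda>\<L>. real (card {C \<in> \<L>. g C \<notin> \<L>}))"
      unfolding a_def by (rule expectation_random_split [symmetric]) (use finA g in auto)
    also have "\<dots> \<le> measure_pmf.expectation (pmf_of_set (Pow A)) (\<lambda>\<L>. real (M E \<L>))"
    proof (rule integral_mono_AE[OF int int], unfold AE_measure_pmf_iff, intro ballI)
      fix \<L> assume "\<L> \<in> set_pmf (pmf_of_set (Pow A))"
      then have \<L>: "\<L> \<subseteq> A" using finPow by simp
      have "{C \<in> \<L>. g C \<notin> \<L>} \<subseteq> {C \<in> \<L>. 0 < edges_between E C (\<Union>(A - \<L>))}"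
        using g \<L> unfolding edges_between_pos_iff[OF G(1)] by blast
      moreover have "finite \<L>" using \<L> finA by (rule finite_subset)
      ultimately show "real (card {C \<in> \<L>. g C \<notin> \<L>}) \<le> real (M E \<L>)"
        unfolding M_def by (simp add: card_mono)
    qed
    finally have "\<beta> * (a / 4) \<le> \<beta> * measure_pmf.expectation (pmf_of_set (Pow A)) (\<lambda>\<L>. real (M E \<L>))"
      using \<alpha> by (rule mult_left_mono)
    moreover have "measure_pmf.expectation (pmf_of_set (Pow A)) (\<lambda>\<L>. c \<L> E) =
        33 * a + Z + round_overhead + \<alpha> +
        \<beta> * (a - measure_pmf.expectation (pmf_of_set (Pow A)) (\<lambda>\<L>. real (M E \<L>)) / 8)"
      unfolding c_def by (simp add: Bochner_Integration.integral_diff[OF int int]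
        Bochner_Integration.integral_add[OF int int])
    ultimately show "measure_pmf.expectation (pmf_of_set (Pow A)) (\<lambda>\<L>. c \<L> E) \<le>
      33 * real (card A) + 6 * sqrt (real (card A) * real (card V)) + round_overhead +
      \<alpha> + \<beta> * (31 / 32 * real (card A))"
      unfolding a_def [symmetric] Z_def [symmetric] by (simp add: algebra_simps)
  qed simp
qed

text \<open>Testing all classes for outgoing edges costs 3 each and leaves only active ones. The
  linear terms 3 + 33 are absorbed through \<open>p \<le> sqrt (p * n)\<close>, so the constant
  becomes 36 + 6 = 42.\<close>

lemma solvable_round:
  assumes \<alpha>: "0 \<le> \<beta>"
    and next_round: "\<And>F' P'. solvable V {E. simple_graph V E \<and> forest_state V E F' P'}
      (\<lambda>_. \<alpha> + \<beta> * real (card P'))"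
  shows "solvable V {E. simple_graph V E \<and> forest_state V E F P}
    (\<lambda>_. 42 * sqrt (real (card P) * real (card V)) + round_overhead +
      \<alpha> + \<beta> * (31 / 32 * real (card P)))"
proof (cases "{E. simple_graph V E \<and> forest_state V E F P} = {}")
  case True
  show ?thesis unfolding True by (rule solvable_empty)
next
  case False
  let ?\<E> = "{E. simple_graph V E \<and> forest_state V E F P}"
  obtain E0 where E0: "simple_graph V E0" "forest_state V E0 F P" using False by auto
  note finP = forest_state_finite[OF E0] and subP = forest_state_subset[OF E0]
  define p where "p = real (card P)"
  define Z where "Z = sqrt (p * real (card V))"
  let ?c = "\<lambda>_. 33 * p + 6 * Z + round_overhead + \<alpha> + \<beta> * (31 / 32 * p)"
  have "solvable V ?\<E> (\<lambda>E. 3 * real (card P) + ?c E)"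
  proof (rule solvable_batch[OF finP, where X = "\<lambda>C. C" and Y = "\<lambda>C. V - C"])
    fix r
    let ?\<E>r = "{E \<in> ?\<E>. \<forall>C\<in>P. edges_between E C (V - C) = r C}"
    define A where "A = {C \<in> P. 0 < r C}"
    have A: "A \<subseteq> P" by (auto simp: A_def)
    show "solvable V ?\<E>r ?c"
    proof (rule solvable_mono[OF solvable_active_round[OF \<alpha> next_round, of F A]])
      fix E assume E: "E \<in> ?\<E>r"
      then have "simple_graph V E" "forest_state V E F P" by auto
      then have "forest_state V E F A"
        by (rule forest_state_remove) (use E A in \<open>auto simp: A_def\<close>)
      then show "E \<in> {E. simple_graph V E \<and> forest_state V E F A \<and>
          (\<forall>C\<in>A. 0 < edges_between E C (V - C))}"
        using E by (auto simp: A_def)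
    next
      have "card A \<le> card P" using A finP by (intro card_mono)
      then have Ap: "real (card A) \<le> p" by (simp add: p_def)
      then have "\<beta> * (31 / 32 * real (card A)) \<le> \<beta> * (31 / 32 * p)" using \<alpha> by (intro mult_left_mono) auto
      moreover have "sqrt (real (card A) * real (card V)) \<le> Z"
        unfolding Z_def using Ap by (intro real_sqrt_le_mono mult_right_mono) auto
      ultimately show "33 * real (card A) + 6 * sqrt (real (card A) * real (card V)) + round_overhead +
          \<alpha> + \<beta> * (31 / 32 * real (card A)) \<le> ?c E" for E :: "'v set set"
        using Ap by simp
    qed
  qed (use subP in auto)
  then show ?thesis
  proof (rule solvable_mono)
    have "p * p \<le> p * real (card V)"
      using card_classes_le[OF E0] by (intro mult_left_mono) (auto simp: p_def)
    then have "p \<le> Z" unfolding Z_def by (intro real_le_rsqrt) (simp add: power2_eq_square)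
    then show "3 * real (card P) + ?c E \<le> 42 * sqrt (real (card P) * real (card V)) + round_overhead +
      \<alpha> + \<beta> * (31 / 32 * real (card P))" for E :: "'v set set"
      unfolding p_def [symmetric] Z_def [symmetric] by simp
  qed simp
qed

text \<open>Shrinking \<open>p\<close> by 31/32 shrinks \<open>sqrt (p * n)\<close> by at most the
  factor 63/64 used as an upper bound for sqrt (31/32). The geometric series of the costs 42 then
  sums to 42 * 64 = 2688; the constant 1344 below is half of it.\<close>

lemma solvable_rounds:
  "solvable V {E. simple_graph V E \<and> forest_state V E F P}
    (\<lambda>_. 2688 * sqrt (real (card P) * real (card V)) + real f * round_overhead +
      (3 + 6 * real b) * (31 / 32) ^ f * real (card P))"
proof (induction f arbitrary: F P)
  case 0
  show ?case by (rule solvable_mono[OF solvable_fallback[OF finite_V card_V]]) auto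
next
  case (Suc f)
  let ?\<E> = "{E. simple_graph V E \<and> forest_state V E F P}"
  define n where "n = real (card V)"
  define p where "p = real (card P)"
  have overhead: "0 \<le> round_overhead" by (simp add: round_overhead_def)
  \<comment> \<open>The tangent argument divides by \<open>s\<close>, so \<open>p * n\<close> has to
    be positive. Without classes the fallback costs nothing.\<close>
  consider "?\<E> = {}" | "p = 0" | "0 < p * n"
  proof (cases "?\<E> = {} \<or> p = 0")
    case False
    then obtain E0 where "simple_graph V E0" "forest_state V E0 F P" by auto
    then have "p \<le> n" using card_classes_le by (auto simp: p_def n_def)
    then show ?thesis using False that(3) by (simp add: p_def)
  qed (use that in auto)
  then show ?case
  proof cases
    case 1
    show ?thesis unfolding 1 by (rule solvable_empty)
  next
    case 2
    then show ?thesis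
      by (intro solvable_mono[OF solvable_fallback[OF finite_V card_V]])
         (use overhead in \<open>auto simp: p_def\<close>)
  next
    case 3
    define s where "s = sqrt (31 / 32 * (p * n))"
    have s: "0 < s" "s * s = 31 / 32 * (p * n)" using 3 by (simp_all add: s_def)
    have s_le: "s \<le> 63 / 64 * sqrt (p * n)"
      unfolding s_def using 3
      by (intro real_le_lsqrt) (simp_all add: power_mult_distrib power2_eq_square mult.commute)
    define \<alpha> where "\<alpha> = 1344 * s + real f * round_overhead"
    define \<beta> where "\<beta> = 1344 * n / s + (3 + 6 * real b) * (31 / 32) ^ f"
    have "solvable V {E. simple_graph V E \<and> forest_state V E F' P'} (\<lambda>_. \<alpha> + \<beta> * real (card P'))" for F' P'
    proof (rule solvable_mono[OF Suc.IH[of F' P']])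
      define x where "x = real (card P')"
      \<comment> \<open>AM-GM replaces the concave bound by its tangent at \<open>31 / 32 * p\<close>.\<close>
      have "sqrt (x * n) \<le> (x * n / s + s) / 2"
      proof (rule real_le_lsqrt)
        have "0 \<le> (x * n / s - s)\<^sup>2" by simp
        moreover have "((x * n / s + s) / 2)\<^sup>2 = (x * n / s - s)\<^sup>2 / 4 + x * n"
          using s(1) by (simp add: power2_eq_square field_simps)
        ultimately show "x * n \<le> ((x * n / s + s) / 2)\<^sup>2" by simp
        show "0 \<le> (x * n / s + s) / 2" using s(1) by (simp add: x_def n_def)
      qed
      then have "2688 * sqrt (x * n) \<le> 2688 * ((x * n / s + s) / 2)" by (rule mult_left_mono) simp
      also have "\<dots> = 1344 * s + 1344 * n / s * x" using s(1) by (simp add: field_simps)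
      finally show "2688 * sqrt (real (card P') * real (card V)) + real f * round_overhead +
          (3 + 6 * real b) * (31 / 32) ^ f * real (card P') \<le> \<alpha> + \<beta> * real (card P')"
        unfolding x_def [symmetric] n_def [symmetric] \<alpha>_def \<beta>_def by (simp add: algebra_simps)
    qed simp
    moreover have "0 \<le> \<beta>" using s(1) by (simp add: \<beta>_def n_def)
    ultimately have "solvable V ?\<E> (\<lambda>_. 42 * sqrt (p * n) + round_overhead + \<alpha> + \<beta> * (31 / 32 * p))"
      unfolding p_def n_def by (intro solvable_round)
    then show ?thesis
    proof (rule solvable_mono)
      have "\<beta> * (31 / 32 * p) = 1344 * (31 / 32 * (p * n)) / s + (3 + 6 * real b) * (31 / 32) ^ Suc f * p"
        by (simp add: \<beta>_def algebra_simps)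
      also have "1344 * (31 / 32 * (p * n)) / s = 1344 * s"
        unfolding s(2) [symmetric] using s(1) by simp
      finally have "\<beta> * (31 / 32 * p) = 1344 * s + (3 + 6 * real b) * (31 / 32) ^ Suc f * p" .
      then have "42 * sqrt (p * n) + round_overhead + \<alpha> + \<beta> * (31 / 32 * p) =
          42 * sqrt (p * n) + 2688 * s + real (Suc f) * round_overhead +
          (3 + 6 * real b) * (31 / 32) ^ Suc f * p"
        by (simp add: \<alpha>_def algebra_simps)
      also have "\<dots> \<le> 2688 * sqrt (p * n) + real (Suc f) * round_overhead +
          (3 + 6 * real b) * (31 / 32) ^ Suc f * p"
        using s_le by simp
      finally show "42 * sqrt (p * n) + round_overhead + \<alpha> + \<beta> * (31 / 32 * p) \<le>
          2688 * sqrt (real (card P) * real (card V)) + real (Suc f) * round_overhead +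
          (3 + 6 * real b) * (31 / 32) ^ Suc f * real (card P)"
        unfolding p_def n_def .
    qed simp
  qed
qed

end

section \<open>The total cost is linear\<close>

text \<open>Used to bound the overhead of all rounds, of order \<open>b ^ 3 * 2 ^ k\<close>, by a
  multiple of \<open>2 ^ b\<close>. Equality at \<open>j = 3\<close> forces the constant 8.\<close>

lemma cube_le_power2: "(j + 1) ^ 3 \<le> 8 * (2 :: nat) ^ j"
proof (induction j rule: less_induct)
  case (less j)
  show ?case
  proof (cases "j \<le> 3")
    case True
    then consider "j = 0" | "j = 1" | "j = 2" | "j = 3" by linarith
    then show ?thesis by cases (simp_all add: power3_eq_cube)
  next
    case False
    then obtain i where i: "j = i + 4" using le_Suc_ex[of 4 j] by (auto simp: add.commute)
    \<comment> \<open>The ratio of the cubes is at most (5/4)^3 < 2, which is why the induction step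
      starts at \<open>j = 4\<close>.\<close>
    have "(i + 5) ^ 3 \<le> 2 * (i + 4) ^ 3" by (simp add: power3_eq_cube algebra_simps)
    moreover have "(i + 4) ^ 3 \<le> 8 * 2 ^ (i + 3)" using less[of "i + 3"] i by (simp add: add.commute)
    ultimately have "(i + 5) ^ 3 \<le> 8 * 2 ^ (i + 4)" by (simp add: power_add)
    moreover have "j + 1 = i + 5" using i by simp
    ultimately show ?thesis by (simp only: i)
  qed
qed

text \<open>27273 = 2688 + 24576 + 9: the geometric series, the overhead of \<open>32 * b\<close>
  rounds, and the fallback on the classes left.\<close>

lemma forest_query_bound:
  fixes V :: "'v set"
  assumes V: "finite V"
  shows "solvable V {E. simple_graph V E} (\<lambda>_. 27273 * real (card V))"
proof -
  define n where "n = card V"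
  define b where "b = (LEAST b. n \<le> 2 ^ b)"
  define k where "k = b div 2"
  have n_le: "n \<le> 2 ^ b" unfolding b_def by (rule LeastI[of _ n]) simp
  have b_min: "b = 0 \<or> 2 ^ b \<le> 2 * n"
  proof (cases b)
    case (Suc j)
    then have "\<not> n \<le> 2 ^ j" using not_less_Least[of j "\<lambda>b. n \<le> 2 ^ b"] by (simp add: b_def)
    then show ?thesis using Suc by simp
  qed simp
  interpret query_parameters V b k
    by unfold_locales (use V n_le in \<open>auto simp: n_def k_def\<close>)
  have overhead: "32 * real b * round_overhead \<le> 24576 * real n"
  proof (cases "b = 0")
    case False
    then have bn: "2 ^ b \<le> 2 * n" using b_min by simp
    \<comment> \<open>As \<open>k\<close> is half of \<open>b\<close> rounded down,
      \<open>2 ^ b\<close> splits into \<open>2 ^ k\<close> from the block size and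
      \<open>2 ^ j\<close> with \<open>b \<le> 2 * j\<close>, which absorbs the cubic factor in
      \<open>b\<close>.\<close>
    define j where "j = b - k"
    have bj: "b \<le> 2 * j" "b = j + k" by (auto simp: j_def k_def)
    have "b * b * (b + 2) \<le> (2 * (j + 1)) * (2 * (j + 1)) * (2 * (j + 1))"
      using bj(1) by (intro mult_le_mono) auto
    also have "\<dots> = 8 * (j + 1) ^ 3" by (simp add: power3_eq_cube algebra_simps)
    also have "\<dots> \<le> 64 * 2 ^ j" using cube_le_power2[of j] by simp
    finally have "b * b * (b + 2) * 2 ^ k \<le> 64 * 2 ^ j * 2 ^ k" by (rule mult_le_mono1)
    also have "\<dots> = 64 * 2 ^ b" by (simp add: bj(2) power_add)
    also have "\<dots> \<le> 128 * n" using bn by simp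
    finally have "real (b * b * (b + 2) * 2 ^ k) \<le> real (128 * n)" by (simp only: of_nat_le_iff)
    then show ?thesis by (simp add: round_overhead_def algebra_simps)
  qed (simp add: round_overhead_def)
  \<comment> \<open>32 rounds at least halve the bound on the expected number of classes, so
    \<open>32 * b\<close> rounds divide it by \<open>2 ^ b\<close>, more than enough to offset the
    factor \<open>3 + 6 * b\<close>.\<close>
  have "(31 / 32 :: real) ^ (32 * b) \<le> (1 / 2) ^ b"
    unfolding power_mult by (rule power_mono) (simp_all add: power_divide)
  then have "(3 + 6 * real b) * (31 / 32) ^ (32 * b) \<le> (3 + 6 * real b) * (1 / 2) ^ b"
    by (intro mult_left_mono) auto
  also have "\<dots> \<le> 9"
  proof -
    have "real b \<le> 2 ^ b" by (rule less_imp_le) (rule of_nat_less_two_power)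
    moreover have "(1 :: real) \<le> 2 ^ b" by simp
    ultimately have "3 + 6 * real b \<le> 9 * 2 ^ b" by linarith
    then show ?thesis by (simp add: power_divide divide_simps)
  qed
  finally have tail: "(3 + 6 * real b) * (31 / 32) ^ (32 * b) * real n \<le> 9 * real n"
    by (intro mult_right_mono) auto
  let ?P = "(\<lambda>v. {v}) ` V"
  have card_P: "card ?P = n" unfolding n_def by (rule card_image) simp
  show ?thesis
  proof (rule solvable_mono[OF solvable_rounds[of "{}" ?P "32 * b"]])
    fix E assume "E \<in> {E. simple_graph V E}"
    then show "E \<in> {E. simple_graph V E \<and> forest_state V E {} ?P}"
      using forest_state_init by simp
  next
    show "2688 * sqrt (real (card ?P) * real (card V)) + real (32 * b) * round_overhead +
      (3 + 6 * real b) * (31 / 32) ^ (32 * b) * real (card ?P) \<le> 27273 * real (card V)"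
      using overhead tail unfolding card_P n_def [symmetric] by simp
  qed
qed

theorem theorem1p2:
  shows "\<exists>(A :: 'v set \<Rightarrow> ('v, 'v set set) cut_alg) (T :: nat \<Rightarrow> real).
    T \<in> O(\<lambda>n. real n) \<and>
    (\<forall>V E. simple_graph V E \<longrightarrow>
       queries_in (Pow V) (cut_query E) (A V) \<and>
       zero_error (cut_query E) (A V) (spanning_forest E) \<and>
       expected_queries (cut_query E) (A V) \<le> ennreal (T (card V)))"
proof -
  \<comment> \<open>One algorithm per vertex set must serve all edge sets, so \<open>A\<close> is
    quantified before \<open>E\<close>; choice over \<open>V\<close> then yields the required
    function.\<close>
  have "\<exists>A :: ('v, 'v set set) cut_alg. \<forall>E. simple_graph V E \<longrightarrow>
      queries_in (Pow V) (cut_query E) A \<and> zero_error (cut_query E) A (spanning_forest E) \<and>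
      expected_queries (cut_query E) A \<le> ennreal (27273 * real (card V))" for V :: "'v set"
  proof (cases "finite V")
    case True
    then show ?thesis using forest_query_bound[OF True] unfolding solvable_def by blast
  qed (simp add: simple_graph_def)
  then obtain A :: "'v set \<Rightarrow> ('v, 'v set set) cut_alg" where A: "\<And>V E. simple_graph V E \<Longrightarrow>
      queries_in (Pow V) (cut_query E) (A V) \<and> zero_error (cut_query E) (A V) (spanning_forest E) \<and>
      expected_queries (cut_query E) (A V) \<le> ennreal (27273 * real (card V))"
    by metis
  have "(\<lambda>n. 27273 * real n) \<in> O(\<lambda>n. real n)" by simp
  then show ?thesis using A by (intro exI[of _ A] exI[of _ "\<lambda>n. 27273 * real n"]) auto
qed

end
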